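(* For all $k,a,m\in\mathbb{C}$ and $t\in\mathbb{R}$, $$\int_0^1 \frac{x^{-1+m}\log^k(ax)}{1-e^{it}x}\,dx=\sum_{n=0}^{\infty} a^{-m-n}\,e^{int}\,(-1)^k\,(m+n)^{-1-k}\,\Gamma\left(1+k,-((m+n)\log(a))\right).$$
   Context: $\log^k(ax)$ means $(\log(ax))^k$. $\Gamma(s,z)$ denotes the upper incomplete gamma function, $\Gamma(s,z)=\int_z^{\infty}u^{s-1}e^{-u}\,du$ for $\operatorname{Re}(s)>0$, extended by analytic continuation to other $s$ (for $z\neq 0$ it is an entire function of $s$). Logarithms and complex powers are principal values; in particular $(-1)^k=e^{i\pi k}$.
   Formalization: False for all k,a,m with principal values (k=1/2, a=-i, m=1, t=π gives RHS=-LHS); proved for a,m≠0, absolutely convergent integral, and k=0,1,2,…, or Arg a≥0 with a=1 or Arg m+Arg log a>0, or k integer with Arg a<0 and Arg m+Arg log a≤0. *)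

theory Defs
  imports "HOL-Analysis.Analysis"
begin

text \<open>
  The path from \<open>z\<close> to \<open>\<infinity>\<close> in the integral for \<open>\<Gamma>(s, z)\<close> is the horizontal ray \<open>z + v\<close>, \<open>v > 0\<close>.
  It meets the branch cut of the principal power only if \<open>z\<close> is itself a negative real; the ray
  then runs along the cut, where the principal argument is \<open>\<pi>\<close>, and passes through \<open>0\<close>, where the
  integrand is integrable because \<open>Re s > 0\<close>.
\<close>
definition upper_Gamma_integral :: "complex \<Rightarrow> complex \<Rightarrow> complex" where
  "upper_Gamma_integral s z =
     (LBINT v:{0<..}. (z + of_real v) powr (s - 1) * exp (- (z + of_real v)))"

text \<open>
  Analytic continuation in \<open>s\<close>, for fixed \<open>z\<close>: to an entire function if \<open>z \<noteq> 0\<close>, and to the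
  complement of the poles \<open>0, -1, -2, \<dots>\<close> if \<open>z = 0\<close>, where the integral is the complete Gamma
  function. These domains are connected, so by the identity theorem the value chosen by \<open>SOME\<close> is
  unique; only \<open>upper_Gamma s 0\<close> with \<open>s\<close> a pole is left unspecified.
\<close>
definition upper_Gamma :: "complex \<Rightarrow> complex \<Rightarrow> complex" where
  "upper_Gamma s z =
     (SOME g. g holomorphic_on (if z = 0 then - \<int>\<^sub>\<le>\<^sub>0 else UNIV) \<and>
              (\<forall>w. Re w > 0 \<longrightarrow> g w = upper_Gamma_integral w z)) s"

text \<open>
  The parameters for which principal values are consistent along the path of the substitution
  \<open>u = -(m + n) log (a x)\<close>, \<open>0 < x < 1\<close>, that is, for which
  \<open>(log (a x)) ^ k = (-1) ^ k (m + n) ^ (-k) u ^ k\<close> holds and \<open>\<Gamma>(1 + k, _)\<close> does not jump.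
  Nothing is required for \<open>k = 0, 1, 2, \<dots>\<close>: then all powers are integral and \<open>\<Gamma>(1 + k, z)\<close>
  is entire in \<open>z\<close>. For \<open>k\<close> not an integer, the second alternative says that
  \<open>Arg u = Arg (m + n) + Arg (log (a x)) - \<pi>\<close> for all \<open>n\<close> and \<open>0 < x \<le> 1\<close> with \<open>a x \<noteq> 1\<close>. For
  \<open>k = -1, -2, \<dots>\<close> it is enough that \<open>u\<close> does not cross the cut \<open>(-\<infinity>, 0]\<close>, which the third
  alternative adds in the case \<open>Arg a < 0\<close>. The bounds on \<open>Arg m\<close> need no index \<open>n\<close> since, for
  \<open>Re m \<ge> 0\<close>, \<open>Arg (m + n)\<close> moves monotonically towards \<open>0\<close>.
\<close>
definition consistent_branches :: "complex \<Rightarrow> complex \<Rightarrow> complex \<Rightarrow> bool" where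
  "consistent_branches k a m \<longleftrightarrow>
     k \<in> \<nat> \<or>
     (0 \<le> Arg a \<and> (a = 1 \<or> 0 < Arg m + Arg (Ln a))) \<or>
     (k \<in> \<int> \<and> Arg a < 0 \<and> Arg m + Arg (Ln a) \<le> 0)"

end

theory Submission
  imports Defs "HOL-Complex_Analysis.Complex_Analysis" "HOL-Real_Asymp.Real_Asymp"
begin

text \<open>
Write \<open>u(x) = -(m + n) log (a x)\<close> for \<open>0 < x < 1\<close>. Since \<open>\<Gamma>(s, u)\<close> has the derivative \<open>- u ^ (s - 1) e ^ (-u)\<close>
in \<open>u\<close> and \<open>e ^ (-u(x)) = (a x) ^ (m + n)\<close>, the function
\<open>a ^ (-m - n) (-1) ^ k (m + n) ^ (-1 - k) \<Gamma>(1 + k, u(x))\<close> is a primitive of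
\<open>x ^ (m + n - 1) log ^ k (a x)\<close>, provided that \<open>log ^ k (a x) = (-1) ^ k (m + n) ^ (-k) u(x) ^ k\<close>; this
identity of principal values is what \<open>consistent_branches\<close> guarantees. As \<open>x\<close> tends to \<open>0\<close>, \<open>u(x)\<close>
runs to infinity along a ray on which the incomplete gamma function vanishes, and as \<open>x\<close> tends to
\<open>1\<close>, \<open>u(x)\<close> tends to \<open>-(m + n) log a\<close>. Hence the integral of \<open>x ^ (m + n - 1) log ^ k (a x)\<close> over
\<open>(0, 1)\<close> is the \<open>n\<close>-th term of the series without the factor \<open>e ^ (i n t)\<close>
(lemma \<open>integral_powr_Ln_powr\<close>). The series is then the expansion of \<open>1 / (1 - e ^ (i t) x)\<close> into a
geometric series: if \<open>F\<close> is the integrand, the partial sums are the integrals of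
\<open>F(x) (1 - (e ^ (i t) x) ^ N)\<close>, and these are dominated by \<open>2 |F|\<close>.

The function \<open>\<Gamma>(s, z)\<close> is given as an analytic continuation in \<open>s\<close>. If \<open>z\<close> is not on the cut
\<open>(-\<infinity>, 0]\<close>, the defining integral along the horizontal ray converges for every \<open>s\<close> to an entire
function, so it is the continuation (\<open>upper_Gamma_eq_integral_off_cut\<close>). If \<open>z < 0\<close>, the ray
runs through \<open>0\<close>; turning it to the direction \<open>1 + i\<close> yields a formula that is entire in \<open>s\<close>, and
identifies the continuation as the limit of \<open>\<Gamma>(s, u)\<close> for \<open>u\<close> tending to \<open>z\<close> from above
(\<open>upper_Gamma_on_cut\<close>).

Two kinds of boundary behaviour need care. Convergence of the integral at \<open>x = 0\<close> forces \<open>Re m > 0\<close>,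
or \<open>Re m = 0\<close> and \<open>Re k < -1\<close>, and this makes \<open>\<Gamma>(1 + k, u(x))\<close> tend to \<open>0\<close>. And \<open>u(x)\<close> may reach the
cut: at \<open>0\<close>, if \<open>a \<ge> 1\<close>, where convergence of the integral forces \<open>Re k > -1\<close> and
\<open>upper_Gamma_integral_tendsto_boundary\<close> gives continuity; at the endpoint \<open>-(m + n) log a < 0\<close> for
negative integers \<open>k\<close>, where it arrives from above; and anywhere if \<open>k\<close> is a natural number, where
\<open>\<Gamma>(1 + k, u)\<close> is entire in \<open>u\<close>.
\<close>

section \<open>Bounds for complex powers and gamma integrands\<close>

lemma norm_powr_le:
  fixes u w :: complex
  shows "norm (u powr w) \<le> norm u powr Re w * exp (pi * \<bar>Im w\<bar>)"
proof -
  have "\<bar>Im w * Arg u\<bar> \<le> \<bar>Im w\<bar> * pi"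
    unfolding abs_mult using Arg_bounded[of u] by (intro mult_left_mono) auto
  then have "- Im w * Arg u \<le> pi * \<bar>Im w\<bar>" by (simp add: mult.commute)
  then show ?thesis unfolding norm_powr_complex by (intro mult_left_mono) auto
qed

lemma norm_powr_ge:
  fixes u w :: complex
  shows "norm u powr Re w * exp (- (pi * \<bar>Im w\<bar>)) \<le> norm (u powr w)"
proof -
  have "\<bar>Im w * Arg u\<bar> \<le> \<bar>Im w\<bar> * pi"
    unfolding abs_mult using Arg_bounded[of u] by (intro mult_left_mono) auto
  then have "- (pi * \<bar>Im w\<bar>) \<le> - Im w * Arg u" by (simp add: mult.commute)
  then show ?thesis unfolding norm_powr_complex by (intro mult_left_mono) auto
qed

lemma powr_between_le:
  fixes x r :: real
  assumes "0 < lo" "lo \<le> x" "x \<le> hi"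
  shows "x powr r \<le> lo powr r + hi powr r"
proof (cases "r \<ge> 0")
  case True
  then have "x powr r \<le> hi powr r" using assms by (intro powr_mono2) auto
  then show ?thesis by (smt (verit) powr_ge_zero)
next
  case False
  then have "x powr r \<le> lo powr r" using assms by (intro powr_mono2') auto
  then show ?thesis by (smt (verit) powr_ge_zero)
qed

lemma powr_add_le:
  fixes x y b :: real
  assumes "x \<ge> 0" "y \<ge> 0" "b \<ge> 0"
  shows "(x + y) powr b \<le> (2 * x) powr b + (2 * y) powr b"
proof (cases "x \<le> y")
  case True
  then have "(x + y) powr b \<le> (2 * y) powr b" using assms by (intro powr_mono2) auto
  then show ?thesis by (smt (verit) powr_ge_zero)
next
  case False
  then have "(x + y) powr b \<le> (2 * x) powr b" using assms by (intro powr_mono2) auto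
  then show ?thesis by (smt (verit) powr_ge_zero)
qed

text \<open>
All dominating functions below are combinations of functions of this form: the exponent \<open>r\<close> comes
from the growth or the singularity of a power, the exponential from \<open>exp (- u)\<close>.
\<close>
lemma set_integrable_powr_exp:
  fixes r a :: real
  assumes "r > -1" "a > 0"
  shows "set_integrable lborel {0<..} (\<lambda>v. v powr r * exp (- a * v))"
proof -
  have "(\<lambda>t. norm (complex_of_real t powr (of_real (r + 1) - 1) / of_real (exp (a * t))))
          absolutely_integrable_on {0<..}"
    by (rule absolutely_integrable_norm[unfolded o_def], rule absolutely_integrable_Gamma_integral)
       (use assms in auto)
  also have "?this \<longleftrightarrow> (\<lambda>v. v powr r * exp (- a * v)) absolutely_integrable_on {0<..}"
    by (intro set_integrable_cong)
       (auto simp: norm_divide norm_powr_real_powr exp_minus field_simps)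
  finally have "set_integrable lebesgue {0<..} (\<lambda>v. v powr r * exp (- a * v))" .
  then show ?thesis
    unfolding set_integrable_def by (subst (asm) integrable_completion) auto
qed

lemma set_integrable_exp_minus:
  fixes a :: real
  assumes "a > 0"
  shows "set_integrable lborel {0<..} (\<lambda>v. exp (- a * v))"
proof -
  have "set_integrable lborel {0<..} (\<lambda>v. v powr 0 * exp (- a * v))"
    using assms by (intro set_integrable_powr_exp) auto
  then show ?thesis by (rule set_integrable_cong[THEN iffD1, rotated 3]) auto
qed

lemma set_integrable_dominated:
  fixes f :: "real \<Rightarrow> complex" and w :: "real \<Rightarrow> real"
  assumes "set_integrable lborel A w" "set_borel_measurable lborel A f"
      and "\<And>x. x \<in> A \<Longrightarrow> norm (f x) \<le> w x"
  shows "set_integrable lborel A f"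
  using assms(1,2)
  by (rule set_integrable_bound) (use assms(3) in \<open>auto intro: order_trans[OF _ abs_ge_self]\<close>)

section \<open>Gamma integrals along a ray as functions of the exponent\<close>

text \<open>
With the weight \<open>exp (b |log u|)\<close> one function dominates \<open>u ^ w exp (-u)\<close> for all \<open>|w| \<le> b\<close>, and
also every partial sum of its expansion in powers of \<open>w\<close>. The weight is at most
\<open>e ^ (b \<pi>) (|u| ^ b + |u| ^ (-b))\<close>, which grows polynomially along a ray that stays away from \<open>0\<close>.
\<close>
lemma ray_dominator:
  fixes z d :: complex and b c :: real
  assumes "Re d > 0" "c > 0" "\<And>s. s > 0 \<Longrightarrow> c \<le> norm (z + d * of_real s)" "b \<ge> 0"
  shows "set_integrable lborel {0<..}
           (\<lambda>s. exp (b * norm (Ln (z + d * of_real s))) * exp (- Re (z + d * of_real s)))"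
proof -
  define C where "C = exp (b * pi) * exp (- Re z)"
  define W where "W = (\<lambda>s. C * (c powr (- b) + (2 * norm z) powr b) * exp (- Re d * s)
                        + C * (2 * norm d) powr b * (s powr b * exp (- Re d * s)))"
  have W: "set_integrable lborel {0<..} W"
    unfolding W_def using assms
    by (intro set_integral_add set_integrable_mult_right set_integrable_powr_exp
              set_integrable_exp_minus) auto
  have bound: "exp (b * norm (Ln (z + d * of_real s))) * exp (- Re (z + d * of_real s)) \<le> W s"
    if s: "s > 0" for s
  proof -
    define u where "u = z + d * of_real s"
    have u: "norm u \<ge> c" "u \<noteq> 0" using assms(2) assms(3)[OF s] by (auto simp: u_def)
    have "norm (Ln u) \<le> \<bar>ln (norm u)\<bar> + pi"
    proof -
      have "norm (Ln u) \<le> \<bar>Re (Ln u)\<bar> + \<bar>Im (Ln u)\<bar>" by (rule cmod_le)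
      also have "\<bar>Im (Ln u)\<bar> \<le> pi" using u(2) by (smt (verit) Im_Ln_le_pi mpi_less_Im_Ln)
      finally show ?thesis using u(2) by simp
    qed
    then have "exp (b * norm (Ln u)) \<le> exp (b * (\<bar>ln (norm u)\<bar> + pi))"
      using assms(4) by (simp add: mult_left_mono)
    also have "\<dots> = exp (b * pi) * exp (b * \<bar>ln (norm u)\<bar>)"
      by (simp add: algebra_simps exp_add)
    also have "exp (b * \<bar>ln (norm u)\<bar>) \<le> norm u powr b + norm u powr (- b)"
    proof (cases "ln (norm u) \<ge> 0")
      case True
      then show ?thesis using u(2) by (simp add: powr_def)
    next
      case False
      then show ?thesis using u(2) by (simp add: powr_def)
    qed
    also have "norm u powr (- b) \<le> c powr (- b)"
      using u assms by (intro powr_mono2') auto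
    also have "norm u powr b \<le> (norm z + norm d * s) powr b"
      unfolding u_def using s assms(4)
      by (intro powr_mono2) (auto intro!: order_trans[OF norm_triangle_ineq] simp: norm_mult)
    also have "\<dots> \<le> (2 * norm z) powr b + (2 * (norm d * s)) powr b"
      using s assms(4) by (intro powr_add_le) auto
    also have "(2 * (norm d * s)) powr b = (2 * norm d) powr b * s powr b"
      using s by (simp add: powr_mult mult.assoc[symmetric])
    finally have *: "exp (b * norm (Ln u))
        \<le> exp (b * pi) * ((2 * norm z) powr b + (2 * norm d) powr b * s powr b + c powr (- b))"
      by simp
    have e: "exp (- Re u) = exp (- Re z) * exp (- Re d * s)"
      by (simp add: u_def exp_add[symmetric])
    have "exp (b * norm (Ln u)) * exp (- Re u)
        \<le> exp (b * pi) * ((2 * norm z) powr b + (2 * norm d) powr b * s powr b + c powr (- b))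
           * exp (- Re u)"
      using * by (rule mult_right_mono) auto
    also have "\<dots> = W s"
      unfolding e by (simp add: W_def C_def algebra_simps)
    finally show ?thesis by (simp only: u_def)
  qed
  show ?thesis
  proof (rule set_integrable_bound[OF W])
    show "set_borel_measurable lborel {0<..} (\<lambda>s. exp (b * norm (Ln (z + d * of_real s)))
            * exp (- Re (z + d * of_real s)))"
      unfolding set_borel_measurable_def by measurable
  qed (use bound in \<open>auto intro: order_trans[OF _ abs_ge_self]\<close>)
qed

lemma norm_powr_le_exp:
  fixes u w :: complex
  shows "norm (u powr w) \<le> exp (norm w * norm (Ln u))"
proof (cases "u = 0")
  case False
  have "Re (w * Ln u) \<le> norm w * norm (Ln u)"
    by (metis complex_Re_le_cmod norm_mult)
  then show ?thesis using False by (simp add: powr_def norm_exp)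
qed simp

lemma ray_integrable:
  fixes z d w :: complex and c :: real
  assumes "Re d > 0" "c > 0" "\<And>s. s > 0 \<Longrightarrow> c \<le> norm (z + d * of_real s)"
  shows "set_integrable lborel {0<..}
           (\<lambda>s. (z + d * of_real s) powr w * exp (- (z + d * of_real s)))"
proof (rule set_integrable_dominated[OF ray_dominator[OF assms, of "norm w"]])
  show "set_borel_measurable lborel {0<..} (\<lambda>s. (z + d * of_real s) powr w * exp (- (z + d * of_real s)))"
    unfolding set_borel_measurable_def by measurable
  show "norm ((z + d * of_real s) powr w * exp (- (z + d * of_real s)))
         \<le> exp (norm w * norm (Ln (z + d * of_real s))) * exp (- Re (z + d * of_real s))"
    for s unfolding norm_mult norm_exp using norm_powr_le_exp by (intro mult_mono) auto
qed auto

text \<open>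
Integrating \<open>u ^ w = \<Sum>j. w ^ j (log u) ^ j / j!\<close> term by term represents the integral by a power
series in \<open>w\<close> that converges everywhere. Continuity of \<open>log\<close> along the ray is not involved, so the
ray may cross the branch cut.
\<close>
lemma ray_entire:
  fixes z d :: complex and c :: real
  assumes "Re d > 0" "c > 0" "\<And>s. s > 0 \<Longrightarrow> c \<le> norm (z + d * of_real s)"
  shows "(\<lambda>w. LBINT s:{0<..}. (z + d * of_real s) powr w * exp (- (z + d * of_real s)))
           holomorphic_on UNIV"
proof -
  define u where "u = (\<lambda>s. z + d * complex_of_real s)"
  have u0: "u s \<noteq> 0" if "s > 0" for s using assms(2) assms(3)[OF that] by (auto simp: u_def)
  have [measurable]: "u \<in> borel_measurable borel" unfolding u_def by measurable
  define a where "a = (\<lambda>j::nat. LBINT s:{0<..}. Ln (u s) ^ j / fact j * exp (- u s))"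
  have term_le: "norm (\<Sum>j<n. w ^ j * (Ln (u s) ^ j / fact j * exp (- u s)))
           \<le> exp (norm w * norm (Ln (u s))) * exp (- Re (u s))" for n s and w :: complex
  proof -
    have "norm (\<Sum>j<n. w ^ j * (Ln (u s) ^ j / fact j * exp (- u s)))
          \<le> (\<Sum>j<n. norm (w ^ j * (Ln (u s) ^ j / fact j * exp (- u s))))"
      by (rule norm_sum)
    also have "\<dots> = (\<Sum>j<n. (norm w * norm (Ln (u s))) ^ j / fact j) * exp (- Re (u s))"
      by (simp add: sum_distrib_right norm_mult norm_divide norm_power norm_exp power_mult_distrib mult.assoc)
    also have "(\<Sum>j<n. (norm w * norm (Ln (u s))) ^ j / fact j) \<le> exp (norm w * norm (Ln (u s)))"
      unfolding exp_def
      using summable_exp_generic[of "norm w * norm (Ln (u s))"]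
      by (simp add: scaleR_conv_of_real divide_inverse mult.commute)
         (intro sum_le_suminf, auto)
    finally show ?thesis by (simp add: mult_right_mono)
  qed
  have term_sums: "(\<lambda>n. \<Sum>j<n. w ^ j * (Ln (u s) ^ j / fact j * exp (- u s)))
            \<longlonglongrightarrow> u s powr w * exp (- u s)" if s: "s > 0" for s and w :: complex
  proof -
    have "(\<lambda>j. (w * Ln (u s)) ^ j /\<^sub>R fact j) sums exp (w * Ln (u s))" by (rule exp_converges)
    then have "(\<lambda>j. (w * Ln (u s)) ^ j /\<^sub>R fact j * exp (- u s)) sums (exp (w * Ln (u s)) * exp (- u s))"
      by (rule sums_mult2)
    then show ?thesis using u0[OF s]
      by (simp add: sums_def powr_def scaleR_conv_of_real power_mult_distrib field_simps)
  qed
  have dom: "integrable lborel (\<lambda>s. indicator {0<..} s *\<^sub>R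
          (exp (norm w * norm (Ln (u s))) * exp (- Re (u s))))" for w :: complex
    using ray_dominator[OF assms, of "norm w"] unfolding u_def set_integrable_def by simp
  have int1: "set_integrable lborel {0<..} (\<lambda>s. w ^ j * (Ln (u s) ^ j / fact j * exp (- u s)))" for j and w :: complex
  proof (rule set_integrable_dominated)
    show "set_integrable lborel {0<..} (\<lambda>s. exp (norm w * norm (Ln (u s))) * exp (- Re (u s)))"
      using dom unfolding set_integrable_def .
    show "set_borel_measurable lborel {0<..} (\<lambda>s. w ^ j * (Ln (u s) ^ j / fact j * exp (- u s)))"
      unfolding set_borel_measurable_def by measurable
    fix s :: real
    have "norm (w ^ j * (Ln (u s) ^ j / fact j * exp (- u s)))
       = ((norm w * norm (Ln (u s))) ^ j / fact j) * exp (- Re (u s))"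
      by (simp add: norm_mult norm_divide norm_power norm_exp power_mult_distrib)
    also have "(norm w * norm (Ln (u s))) ^ j / fact j \<le> exp (norm w * norm (Ln (u s)))"
      unfolding exp_def
      using summable_exp_generic[of "norm w * norm (Ln (u s))"]
        sum_le_suminf[OF summable_exp_generic[of "norm w * norm (Ln (u s))"], of "{j}"]
      by (simp add: divide_inverse mult.commute)
    finally show "norm (w ^ j * (Ln (u s) ^ j / fact j * exp (- u s)))
       \<le> exp (norm w * norm (Ln (u s))) * exp (- Re (u s))" by (simp add: mult_right_mono)
  qed
  have sums: "(\<lambda>j. a j * (w - 0) ^ j) sums (LBINT s:{0<..}. u s powr w * exp (- u s))" for w
  proof -
    have "(\<lambda>n. LINT s|lborel. indicator {0<..} s *\<^sub>R
               (\<Sum>j<n. w ^ j * (Ln (u s) ^ j / fact j * exp (- u s))))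
           \<longlonglongrightarrow> (LINT s|lborel. indicator {0<..} s *\<^sub>R (u s powr w * exp (- u s)))"
    proof (rule integral_dominated_convergence[OF _ _ dom[of w]])
      show "AE s in lborel. (\<lambda>n. indicator {0<..} s *\<^sub>R
               (\<Sum>j<n. w ^ j * (Ln (u s) ^ j / fact j * exp (- u s))))
           \<longlonglongrightarrow> indicator {0<..} s *\<^sub>R (u s powr w * exp (- u s))"
        using term_sums[of _ w] by (intro AE_I2) (auto simp: indicator_def)
      show "AE s in lborel. norm (indicator {0<..} s *\<^sub>R
               (\<Sum>j<n. w ^ j * (Ln (u s) ^ j / fact j * exp (- u s))))
             \<le> indicator {0<..} s *\<^sub>R (exp (norm w * norm (Ln (u s))) * exp (- Re (u s)))" for n
        using term_le by (intro AE_I2) (auto simp: indicator_def)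
    qed measurable
    also have "(\<lambda>n. LINT s|lborel. indicator {0<..} s *\<^sub>R
               (\<Sum>j<n. w ^ j * (Ln (u s) ^ j / fact j * exp (- u s))))
             = (\<lambda>n. \<Sum>j<n. a j * (w - 0) ^ j)"
    proof
      fix n
      have "(LINT s|lborel. indicator {0<..} s *\<^sub>R
               (\<Sum>j<n. w ^ j * (Ln (u s) ^ j / fact j * exp (- u s))))
          = (\<Sum>j<n. LBINT s:{0<..}. w ^ j * (Ln (u s) ^ j / fact j * exp (- u s)))"
        unfolding set_lebesgue_integral_def scaleR_sum_right
        using int1[unfolded set_integrable_def] by (intro Bochner_Integration.integral_sum) auto
      also have "\<dots> = (\<Sum>j<n. a j * (w - 0) ^ j)"
        by (simp add: a_def mult.commute)
      finally show "(LINT s|lborel. indicator {0<..} s *\<^sub>R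
               (\<Sum>j<n. w ^ j * (Ln (u s) ^ j / fact j * exp (- u s))))
          = (\<Sum>j<n. a j * (w - 0) ^ j)" .
    qed
    finally show ?thesis by (simp add: sums_def set_lebesgue_integral_def)
  qed
  have "(\<lambda>w. LBINT s:{0<..}. u s powr w * exp (- u s)) holomorphic_on ball 0 r" for r
    by (rule power_series_holomorphic[OF sums])
  then have "(\<lambda>w. LBINT s:{0<..}. u s powr w * exp (- u s)) holomorphic_on (\<Union>r. ball 0 r)"
    by (subst holomorphic_on_UN_open) auto
  moreover have "(\<Union>r. ball (0::complex) r) = UNIV"
    by (auto intro: gt_ex)
  ultimately show ?thesis by (simp add: u_def)
qed

section \<open>The incomplete gamma integral as a function of its base point\<close>

lemma horizontal_ray_gap:
  fixes u :: complex
  assumes "u \<notin> \<real>\<^sub>\<le>\<^sub>0"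
  shows "\<exists>c>0. \<forall>v>0. c \<le> norm (u + of_real v)"
proof (cases "Im u = 0")
  case True
  then have "Re u > 0" using assms by (auto simp: complex_nonpos_Reals_iff)
  moreover have "Re u \<le> norm (u + of_real v)" if "v > 0" for v
    using complex_Re_le_cmod[of "u + of_real v"] that by simp
  ultimately show ?thesis by blast
next
  case False
  moreover have "\<bar>Im u\<bar> \<le> norm (u + of_real v)" for v
    using abs_Im_le_cmod[of "u + of_real v"] by simp
  ultimately show ?thesis by (intro exI[of _ "\<bar>Im u\<bar>"]) auto
qed

lemma upper_Gamma_integrable:
  fixes u s :: complex
  assumes "u \<notin> \<real>\<^sub>\<le>\<^sub>0"
  shows "set_integrable lborel {0<..}
           (\<lambda>v. (u + of_real v) powr (s - 1) * exp (- (u + of_real v)))"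
proof -
  obtain c where "c > 0" "\<And>v. v > 0 \<Longrightarrow> c \<le> norm (u + of_real v)"
    using horizontal_ray_gap[OF assms] by blast
  then show ?thesis using ray_integrable[of 1 c u "s - 1"] by simp
qed

lemma starlike_slit_plane: "starlike (- \<real>\<^sub>\<le>\<^sub>0 :: complex set)"
  unfolding starlike_def
proof (intro bexI ballI subsetI)
  fix x y :: complex
  assume x: "x \<in> - \<real>\<^sub>\<le>\<^sub>0" and y: "y \<in> closed_segment 1 x"
  then obtain t where t: "0 \<le> t" "t \<le> 1" "y = (1 - t) *\<^sub>R 1 + t *\<^sub>R x"
    by (auto simp: closed_segment_def)
  show "y \<in> - \<real>\<^sub>\<le>\<^sub>0"
  proof (cases "Im x = 0")
    case True
    then have "Re x > 0" using x by (auto simp: complex_nonpos_Reals_iff)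
    then have "Re y > 0" using t
      by (cases "t = 1") (auto intro!: add_pos_nonneg)
    then show ?thesis by (auto simp: complex_nonpos_Reals_iff)
  next
    case False
    then show ?thesis using t by (auto simp: complex_nonpos_Reals_iff)
  qed
qed (auto simp: complex_nonpos_Reals_iff)

text \<open>
The segment from \<open>u + R\<close> to \<open>1 + R\<close> has constant length, while \<open>q ^ (s - 1) exp (-q)\<close> decays
exponentially on it. So a primitive has the same limit at infinity along all horizontal rays.
\<close>
lemma primitive_shift_diff_tendsto_0:
  fixes P :: "complex \<Rightarrow> complex"
  assumes P: "\<And>q. q \<notin> \<real>\<^sub>\<le>\<^sub>0 \<Longrightarrow> (P has_field_derivative q powr (s - 1) * exp (- q)) (at q)"
  shows "((\<lambda>R::real. P (u + of_real R) - P (1 + of_real R)) \<longlongrightarrow> 0) at_top"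
proof (rule Lim_null_comparison)
  define a where "a = \<bar>Re (s - 1)\<bar>"
  define E where "E = exp (pi * \<bar>Im (s - 1)\<bar>)"
  define N where "N = norm u"
  have N: "N \<ge> 0" and a: "a \<ge> 0" by (simp_all add: N_def a_def)
  show "\<forall>\<^sub>F R in at_top. norm (P (u + of_real R) - P (1 + of_real R))
          \<le> E * norm (u - 1) * ((R + (N + 1)) powr a * exp (- (R - N)))"
    using eventually_gt_at_top[of "N + 1"]
  proof eventually_elim
    case (elim R)
    define S where "S = closed_segment (u + of_real R) (1 + of_real R)"
    have S: "q \<notin> \<real>\<^sub>\<le>\<^sub>0 \<and> norm (q powr (s - 1) * exp (- q)) \<le> E * ((R + (N + 1)) powr a * exp (- (R - N)))"
      if q: "q \<in> S" for q
    proof -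
      obtain t where t: "0 \<le> t" "t \<le> 1" "q = (1 - t) *\<^sub>R (u + of_real R) + t *\<^sub>R (1 + of_real R)"
        using q unfolding S_def in_segment by auto
      have Ru: "Re u \<ge> - N" using abs_Re_le_cmod[of u] by (auto simp: N_def)
      have "Re q = R + (1 - t) * Re u + t"
        unfolding t(3) by (simp add: algebra_simps)
      moreover have "(1 - t) * Re u \<ge> (1 - t) * (- N)" using t Ru by (intro mult_left_mono) auto
      moreover have "(1 - t) * (- N) \<ge> - N" using t N by (simp add: algebra_simps)
      ultimately have Re: "Re q \<ge> R - N" using t by linarith
      have "q = of_real R + (1 - t) *\<^sub>R u + of_real t"
        unfolding t(3) by (simp add: scaleR_conv_of_real algebra_simps)
      then have "norm q \<le> \<bar>R\<bar> + norm ((1 - t) *\<^sub>R u) + \<bar>t\<bar>"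
        using norm_triangle_ineq[of "of_real R + (1 - t) *\<^sub>R u" "of_real t"]
              norm_triangle_ineq[of "of_real R" "(1 - t) *\<^sub>R u"] by simp
      also have "norm ((1 - t) *\<^sub>R u) \<le> N"
        using t mult_right_mono[of "1 - t" 1 N] N by (simp add: N_def)
      finally have nq: "norm q \<le> R + (N + 1)" using t elim N by linarith
      have nq1: "norm q \<ge> 1" using Re elim complex_Re_le_cmod[of q] by linarith
      have "norm (q powr (s - 1)) \<le> norm q powr Re (s - 1) * E"
        unfolding E_def by (rule norm_powr_le)
      also have "norm q powr Re (s - 1) \<le> norm q powr a"
        unfolding a_def using nq1 by (intro powr_mono) auto
      also have "\<dots> \<le> (R + (N + 1)) powr a"
        using nq nq1 a by (intro powr_mono2) auto
      finally have 1: "norm (q powr (s - 1)) \<le> (R + (N + 1)) powr a * E"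
        by (simp add: E_def)
      have "norm (q powr (s - 1) * exp (- q)) \<le> ((R + (N + 1)) powr a * E) * exp (- (R - N))"
        unfolding norm_mult using 1 Re by (intro mult_mono) (auto simp: E_def)
      moreover have "q \<notin> \<real>\<^sub>\<le>\<^sub>0" using Re elim by (auto simp: complex_nonpos_Reals_iff)
      ultimately show ?thesis by (simp add: mult_ac)
    qed
    have "norm (P (u + of_real R) - P (1 + of_real R))
       \<le> E * ((R + (N + 1)) powr a * exp (- (R - N))) * norm ((u + of_real R) - (1 + of_real R))"
    proof (rule field_differentiable_bound[of S])
      show "(P has_field_derivative q powr (s - 1) * exp (- q)) (at q within S)" if "q \<in> S" for q
        using S[OF that] P has_field_derivative_at_within by blast
    qed (use S in \<open>auto simp: S_def\<close>)
    then show ?case by (simp add: mult_ac)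
  qed
  have "((\<lambda>R. (R + (N + 1)) powr a * exp (- (R - N))) \<longlongrightarrow> 0) at_top"
    using a by real_asymp
  from tendsto_mult_right_zero[OF this]
  show "((\<lambda>R. E * norm (u - 1) * ((R + (N + 1)) powr a * exp (- (R - N)))) \<longlongrightarrow> 0) at_top" .
qed

text \<open>
On the starlike slit plane the integrand has a primitive \<open>P\<close>. The integral over the ray from \<open>q\<close> is
\<open>P(\<infinity>) - P(q)\<close>, and \<open>P(\<infinity>)\<close> does not depend on \<open>q\<close>.
\<close>
lemma has_field_derivative_upper_Gamma_integral:
  assumes u: "u \<notin> \<real>\<^sub>\<le>\<^sub>0"
  shows "(upper_Gamma_integral s has_field_derivative - (u powr (s - 1) * exp (- u))) (at u)"
proof -
  define g where "g = (\<lambda>q::complex. q powr (s - 1) * exp (- q))"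
  have holo: "g holomorphic_on (- \<real>\<^sub>\<le>\<^sub>0)"
    unfolding g_def by (intro holomorphic_intros) auto
  have op: "open (- \<real>\<^sub>\<le>\<^sub>0 :: complex set)" by auto
  obtain P where P: "\<And>q. q \<notin> \<real>\<^sub>\<le>\<^sub>0 \<Longrightarrow> (P has_field_derivative g q) (at q)"
    using holomorphic_starlike_primitive[OF holomorphic_on_imp_continuous_on[OF holo]
        starlike_slit_plane op finite.emptyI] holo op
    by (auto dest: holomorphic_on_imp_differentiable_at)
  have lim: "((\<lambda>R::real. P (q + of_real R)) \<longlongrightarrow> P q + upper_Gamma_integral s q) at_top"
    if q: "q \<notin> \<real>\<^sub>\<le>\<^sub>0" for q
  proof -
    have "set_integrable lborel {0<..} (\<lambda>v. g (q + of_real v))"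
      unfolding g_def by (rule upper_Gamma_integrable[OF q])
    moreover have "set_integrable lborel {0<..} (\<lambda>v. g (q + of_real v)) \<longleftrightarrow>
                   set_integrable lborel {0..} (\<lambda>v. g (q + of_real v))"
      by (rule set_integrable_discrete_difference[of "{0}"]) auto
    ultimately have int: "set_integrable lborel {0..} (\<lambda>v. g (q + of_real v))" by simp
    have eq: "(LBINT v:{0..}. g (q + of_real v)) = upper_Gamma_integral s q"
      unfolding upper_Gamma_integral_def g_def
      by (rule set_integral_discrete_difference[of "{0}"]) auto
    have fin: "(LBINT v:{0..R}. g (q + of_real v)) = P (q + of_real R) - P q" if "R \<ge> 0" for R
    proof -
      have qv: "q + of_real v \<notin> \<real>\<^sub>\<le>\<^sub>0" if "v \<ge> 0" for v
        using q that by (auto simp: complex_nonpos_Reals_iff)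
      have "((\<lambda>v. P (q + of_real v)) has_vector_derivative g (q + of_real v)) (at v within {0..R})"
        if "v \<in> {0..R}" for v
      proof -
        have "(P has_field_derivative g (q + of_real v)) (at (of_real v + q))"
          using P[OF qv[of v]] that by (simp add: add.commute)
        then have "((\<lambda>w. P (w + q)) has_field_derivative g (q + of_real v)) (at (of_real v))"
          by (rule DERIV_shift[THEN iffD1])
        then have "((\<lambda>w. P (q + w)) has_field_derivative g (q + of_real v)) (at (of_real v))"
          by (simp only: add.commute)
        from has_vector_derivative_real_field[OF this] show ?thesis
          by (simp add: has_vector_derivative_at_within)
      qed
      then have "((\<lambda>v. g (q + of_real v)) has_integral P (q + of_real R) - P (q + of_real 0)) {0..R}"
        using that by (intro fundamental_theorem_of_calculus) auto
      moreover have "set_integrable lborel {0..R} (\<lambda>v. g (q + of_real v))"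
        using int by (rule set_integrable_subset) auto
      ultimately show ?thesis
        by (simp add: set_borel_integral_eq_integral(2) integral_unique)
    qed
    have "((\<lambda>R. LBINT v:{0..R}. g (q + of_real v)) \<longlongrightarrow> upper_Gamma_integral s q) at_top"
      using tendsto_set_lebesgue_integral_at_top[OF _ int] eq by simp
    then have "((\<lambda>R. P (q + of_real R) - P q) \<longlongrightarrow> upper_Gamma_integral s q) at_top"
      by (rule Lim_transform_eventually) (use fin in \<open>auto intro: eventually_mono[OF eventually_ge_at_top[of 0]]\<close>)
    from tendsto_add[OF tendsto_const[of "P q"] this] show ?thesis by simp
  qed
  have eq: "upper_Gamma_integral s q = P 1 + upper_Gamma_integral s 1 - P q" if q: "q \<notin> \<real>\<^sub>\<le>\<^sub>0" for q
  proof -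
    have "((\<lambda>R::real. P (q + of_real R) - P (1 + of_real R)) \<longlongrightarrow>
            (P q + upper_Gamma_integral s q) - (P 1 + upper_Gamma_integral s 1)) at_top"
      by (intro tendsto_diff lim q) (auto simp: complex_nonpos_Reals_iff)
    moreover have "((\<lambda>R::real. P (q + of_real R) - P (1 + of_real R)) \<longlongrightarrow> 0) at_top"
      by (rule primitive_shift_diff_tendsto_0[of P s]) (use P in \<open>simp add: g_def\<close>)
    ultimately have "(P q + upper_Gamma_integral s q) - (P 1 + upper_Gamma_integral s 1) = 0"
      by (intro tendsto_unique[OF trivial_limit_at_top_linorder])
    then show ?thesis by (simp add: algebra_simps)
  qed
  have "((\<lambda>q. P 1 + upper_Gamma_integral s 1 - P q) has_field_derivative - g u) (at u)"
    by (auto intro!: derivative_eq_intros P u)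
  then have "(upper_Gamma_integral s has_field_derivative - g u) (at u)"
    by (rule has_field_derivative_transform_within_open[OF _ op]) (use u in \<open>auto intro!: eq[symmetric]\<close>)
  then show ?thesis by (simp add: g_def)
qed

text \<open>
The two conditions on \<open>u\<close> confine \<open>|u + v| / |u|\<close> to the interval from \<open>c\<close> to \<open>1 + v\<close>. Pulling out
\<open>|u| ^ (Re s - 1) exp (- Re u)\<close> then leaves a dominating function that does not depend on \<open>u\<close>.
\<close>
lemma upper_Gamma_integral_norm_le:
  assumes c: "0 < c"
  obtains C where "\<And>u. 1 \<le> norm u \<Longrightarrow> (\<And>v. v > 0 \<Longrightarrow> c * norm u \<le> norm (u + of_real v)) \<Longrightarrow>
      norm (upper_Gamma_integral s u) \<le> C * (norm u powr (Re s - 1) * exp (- Re u))"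
proof -
  define r where "r = Re s - 1"
  define E where "E = exp (pi * \<bar>Im s\<bar>)"
  define W where "W = (\<lambda>v. E * (c powr r + 2 powr \<bar>r\<bar>) * exp (- 1 * v)
                        + E * 2 powr \<bar>r\<bar> * (v powr \<bar>r\<bar> * exp (- 1 * v)))"
  have W: "set_integrable lborel {0<..} W"
    unfolding W_def
    by (intro set_integral_add set_integrable_mult_right set_integrable_powr_exp
              set_integrable_exp_minus) auto
  show ?thesis
  proof (rule that[of "LBINT v:{0<..}. W v"])
    fix u :: complex
    assume u: "1 \<le> norm u" and gap: "\<And>v. v > 0 \<Longrightarrow> c * norm u \<le> norm (u + of_real v)"
    define K where "K = norm u powr r * exp (- Re u)"
    have K: "K \<ge> 0" by (simp add: K_def)
    have bound: "norm ((u + of_real v) powr (s - 1) * exp (- (u + of_real v))) \<le> K * W v"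
      if v: "v > 0" for v
    proof -
      define x where "x = norm (u + of_real v) / norm u"
      have un: "norm u > 0" using u by linarith
      have "norm (u + of_real v) \<le> norm u + v" using norm_triangle_ineq[of u "of_real v"] v by simp
      also have "\<dots> \<le> norm u * (1 + v)" using u v mult_right_mono[of 1 "norm u" v] by (simp add: algebra_simps)
      finally have x2: "x \<le> 1 + v" using un by (simp add: x_def field_simps)
      have x1: "c \<le> x" using gap[OF v] un by (simp add: x_def field_simps)
      have "x powr r \<le> c powr r + (1 + v) powr r" by (rule powr_between_le[OF c x1 x2])
      also have "(1 + v) powr r \<le> (1 + v) powr \<bar>r\<bar>" using v by (intro powr_mono) auto
      also have "\<dots> \<le> (2 * 1) powr \<bar>r\<bar> + (2 * v) powr \<bar>r\<bar>" using v by (intro powr_add_le) auto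
      also have "(2 * v) powr \<bar>r\<bar> = 2 powr \<bar>r\<bar> * v powr \<bar>r\<bar>" using v by (simp add: powr_mult)
      finally have x3: "x powr r \<le> c powr r + 2 powr \<bar>r\<bar> + 2 powr \<bar>r\<bar> * v powr \<bar>r\<bar>" by simp
      have "norm ((u + of_real v) powr (s - 1)) \<le> norm (u + of_real v) powr r * E"
        using norm_powr_le[of "u + of_real v" "s - 1"] by (simp add: r_def E_def)
      also have "norm (u + of_real v) = norm u * x" using un by (simp add: x_def)
      also have "(norm u * x) powr r = norm u powr r * x powr r"
        using c x1 by (simp add: powr_mult)
      also have "norm u powr r * x powr r * E
          \<le> norm u powr r * (c powr r + 2 powr \<bar>r\<bar> + 2 powr \<bar>r\<bar> * v powr \<bar>r\<bar>) * E"
        using x3 by (intro mult_right_mono mult_left_mono) (auto simp: E_def)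
      finally have "norm ((u + of_real v) powr (s - 1)) * exp (- (Re u + v))
          \<le> norm u powr r * (c powr r + 2 powr \<bar>r\<bar> + 2 powr \<bar>r\<bar> * v powr \<bar>r\<bar>) * E
             * exp (- (Re u + v))"
        by (rule mult_right_mono) auto
      also have "\<dots> = K * W v"
        by (simp add: K_def W_def exp_add exp_diff exp_minus field_simps)
      finally show ?thesis by (simp add: norm_mult)
    qed
    have KW: "set_integrable lborel {0<..} (\<lambda>v. K * W v)"
      using W by (rule set_integrable_mult_right)
    have int: "set_integrable lborel {0<..}
           (\<lambda>v. (u + of_real v) powr (s - 1) * exp (- (u + of_real v)))"
    proof (rule set_integrable_dominated[OF KW])
      show "set_borel_measurable lborel {0<..}
             (\<lambda>v. (u + of_real v) powr (s - 1) * exp (- (u + of_real v)))"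
        unfolding set_borel_measurable_def by measurable
    qed (use bound in auto)
    have "norm (upper_Gamma_integral s u) \<le> (LBINT v:{0<..}. K * W v)"
      unfolding upper_Gamma_integral_def set_lebesgue_integral_def
    proof (rule Bochner_Integration.integral_norm_bound_integral)
      show "integrable lborel (\<lambda>v. indicator {0<..} v *\<^sub>R
              ((u + of_real v) powr (s - 1) * exp (- (u + of_real v))))"
        using int unfolding set_integrable_def .
      show "integrable lborel (\<lambda>v. indicator {0<..} v *\<^sub>R (K * W v))"
        using KW unfolding set_integrable_def .
    qed (use bound in \<open>auto simp: indicator_def\<close>)
    then show "norm (upper_Gamma_integral s u)
        \<le> (LBINT v:{0<..}. W v) * (norm u powr (Re s - 1) * exp (- Re u))"
      by (simp add: K_def r_def mult_ac)
  qed
qed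

lemma integrable_abs_powr_exp:
  fixes r :: real
  assumes "r > -1"
  shows "integrable lborel (\<lambda>t. \<bar>t\<bar> powr r * exp (- \<bar>t\<bar>))"
proof -
  define f where "f = (\<lambda>t::real. indicator {0<..} t *\<^sub>R (t powr r * exp (- 1 * t)))"
  have f: "integrable lborel f"
    using set_integrable_powr_exp[OF assms, of 1] unfolding f_def set_integrable_def by simp
  have "integrable lborel (\<lambda>t. f t + f (0 + (-1) * t))"
    by (intro Bochner_Integration.integrable_add f lborel_integrable_real_affine) auto
  also have "(\<lambda>t. f t + f (0 + (-1) * t)) = (\<lambda>t. \<bar>t\<bar> powr r * exp (- \<bar>t\<bar>))"
    by (auto simp: f_def fun_eq_iff indicator_def)
  finally show ?thesis .
qed

text \<open>
On the closed upper half plane the principal logarithm agrees with a branch that is cut along the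
negative imaginary axis and is therefore continuous at the negative reals.
\<close>
lemma Ln_eq_rotated:
  fixes q :: complex
  assumes "Im q \<ge> 0" "q \<noteq> 0"
  shows "Ln q = Ln (- \<i> * q) + \<i> * of_real pi / 2"
  using Ln_times_ii[of "- \<i> * q"] assms by (simp add: mult.assoc[symmetric])

text \<open>
Dominated convergence. The comparison with \<open>|z + v|\<close> keeps the singularity of the integrands near
\<open>v = -z\<close> below a multiple of \<open>|z + v| ^ (Re s - 1)\<close>, which is integrable there as \<open>Re s > 0\<close>. For
pointwise convergence at \<open>z + v < 0\<close> the points must come from the closed upper half plane, from
which the principal logarithm is continuous on the cut.
\<close>
lemma upper_Gamma_integral_tendsto_boundary:
  fixes X :: "nat \<Rightarrow> complex" and s z :: complex
  assumes s: "Re s > 0" and z: "Im z = 0" "Re z \<le> 0" and lim: "X \<longlonglongrightarrow> z" and c: "c > 0"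
    and gap: "\<And>n v. v > 0 \<Longrightarrow> c * norm (z + of_real v) \<le> norm (X n + of_real v)"
    and side: "z = 0 \<or> (\<forall>n. Im (X n) \<ge> 0)"
  shows "(\<lambda>n. upper_Gamma_integral s (X n)) \<longlonglongrightarrow> upper_Gamma_integral s z"
proof -
  define r where "r = Re s - 1"
  define y where "y = - Re z"
  define E where "E = exp (pi * \<bar>Im s\<bar>)"
  have zy: "z = - of_real y" using z by (simp add: y_def complex_eq_iff)
  have y: "y \<ge> 0" using z by (simp add: y_def)
  obtain M0 where M0: "\<And>n. norm (X n) \<le> M0"
    using convergent_imp_Bseq[OF convergentI[OF lim]] by (auto simp: Bseq_def)
  define M where "M = max 1 M0"
  have M: "M \<ge> 1" "\<And>n. norm (X n) \<le> M" using M0 by (auto simp: M_def le_max_iff_disj)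
  define W where "W = (\<lambda>v. E * exp M * c powr r * exp y * (\<bar>- y + 1 * v\<bar> powr r * exp (- \<bar>- y + 1 * v\<bar>))
                        + (E * exp M * (2 * M) powr \<bar>r\<bar> * exp (- 1 * v)
                        + E * exp M * 2 powr \<bar>r\<bar> * (v powr \<bar>r\<bar> * exp (- 1 * v))))"
  have "integrable lborel (\<lambda>v. \<bar>- y + 1 * v\<bar> powr r * exp (- \<bar>- y + 1 * v\<bar>))"
    by (rule lborel_integrable_real_affine[OF integrable_abs_powr_exp]) (use s in \<open>auto simp: r_def\<close>)
  then have "set_integrable lborel {0<..} (\<lambda>v. \<bar>- y + 1 * v\<bar> powr r * exp (- \<bar>- y + 1 * v\<bar>))"
    unfolding set_integrable_def by (rule integrable_mult_indicator[rotated]) auto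
  then have W: "set_integrable lborel {0<..} W"
    unfolding W_def
    by (intro set_integral_add set_integrable_mult_right set_integrable_powr_exp
              set_integrable_exp_minus) auto
  define f where "f = (\<lambda>u v. (u + of_real v) powr (s - 1) * exp (- (u + complex_of_real v)))"
  have [measurable]: "f u \<in> borel_measurable borel" for u unfolding f_def by measurable
  have bound: "norm (f (X n) v) \<le> W v" if v: "v > 0" "v \<noteq> y" for n v
  proof -
    have zv: "norm (z + of_real v) = \<bar>- y + 1 * v\<bar>"
      unfolding zy using norm_of_real[of "- y + v"] by (simp add: algebra_simps)
    have pos: "c * \<bar>- y + 1 * v\<bar> > 0" using c v by auto
    have "norm (X n + of_real v) \<le> M + v"
      using norm_triangle_ineq[of "X n" "of_real v"] M(2)[of n] v by simp
    then have "norm (X n + of_real v) powr r \<le> (c * \<bar>- y + 1 * v\<bar>) powr r + (M + v) powr r"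
      using gap[OF v(1), of n] zv by (intro powr_between_le pos) auto
    also have "(c * \<bar>- y + 1 * v\<bar>) powr r = c powr r * \<bar>- y + 1 * v\<bar> powr r"
      using c by (simp add: powr_mult)
    also have "(M + v) powr r \<le> (M + v) powr \<bar>r\<bar>" using v M by (intro powr_mono) auto
    also have "\<dots> \<le> (2 * M) powr \<bar>r\<bar> + (2 * v) powr \<bar>r\<bar>" using v M by (intro powr_add_le) auto
    also have "(2 * v) powr \<bar>r\<bar> = 2 powr \<bar>r\<bar> * v powr \<bar>r\<bar>" using v by (simp add: powr_mult)
    finally have 1: "norm (X n + of_real v) powr r \<le>
        c powr r * \<bar>- y + 1 * v\<bar> powr r + ((2 * M) powr \<bar>r\<bar> + 2 powr \<bar>r\<bar> * v powr \<bar>r\<bar>)" by simp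
    have "norm ((X n + of_real v) powr (s - 1)) \<le> norm (X n + of_real v) powr r * E"
      using norm_powr_le[of "X n + of_real v" "s - 1"] by (simp add: r_def E_def)
    also have "\<dots> \<le> (c powr r * \<bar>- y + 1 * v\<bar> powr r + ((2 * M) powr \<bar>r\<bar> + 2 powr \<bar>r\<bar> * v powr \<bar>r\<bar>)) * E"
      using 1 by (rule mult_right_mono) (auto simp: E_def)
    finally have 2: "norm ((X n + of_real v) powr (s - 1)) \<le>
        (c powr r * \<bar>- y + 1 * v\<bar> powr r + ((2 * M) powr \<bar>r\<bar> + 2 powr \<bar>r\<bar> * v powr \<bar>r\<bar>)) * E" .
    have "- Re (X n) \<le> M" using abs_Re_le_cmod[of "X n"] M(2)[of n] by linarith
    then have 3: "norm (exp (- (X n + complex_of_real v))) \<le> exp M * exp (- v)"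
      by (simp add: exp_add[symmetric])
    have "norm (f (X n) v) \<le>
        (c powr r * \<bar>- y + 1 * v\<bar> powr r + ((2 * M) powr \<bar>r\<bar> + 2 powr \<bar>r\<bar> * v powr \<bar>r\<bar>)) * E
          * (exp M * exp (- v))"
      unfolding f_def norm_mult by (rule mult_mono[OF 2 3 order_trans[OF norm_ge_zero 2]]) simp
    also have "\<dots> = E * exp M * c powr r * (\<bar>- y + 1 * v\<bar> powr r * exp (- v))
        + (E * exp M * (2 * M) powr \<bar>r\<bar> * exp (- 1 * v)
                        + E * exp M * 2 powr \<bar>r\<bar> * (v powr \<bar>r\<bar> * exp (- 1 * v)))"
      by (simp add: algebra_simps)
    also have "\<dots> \<le> W v"
    proof -
      have "exp (- v) \<le> exp y * exp (- \<bar>- y + 1 * v\<bar>)"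
        unfolding exp_add[symmetric] using y v by auto
      then have "E * exp M * c powr r * (\<bar>- y + 1 * v\<bar> powr r * exp (- v))
         \<le> E * exp M * c powr r * (\<bar>- y + 1 * v\<bar> powr r * (exp y * exp (- \<bar>- y + 1 * v\<bar>)))"
        by (intro mult_left_mono) (auto simp: E_def)
      then show ?thesis by (simp add: W_def mult_ac)
    qed
    finally show ?thesis .
  qed
  have ptw: "(\<lambda>n. f (X n) v) \<longlonglongrightarrow> f z v" if v: "v > 0" "v \<noteq> y" for v
  proof -
    have Xv: "(\<lambda>n. X n + of_real v) \<longlonglongrightarrow> z + of_real v" by (intro tendsto_intros lim)
    have zv: "z + of_real v = of_real (v - y)" by (simp add: zy)
    have nz: "z + of_real v \<noteq> 0" using v by (simp add: zv)
    have "(\<lambda>n. Ln (X n + of_real v)) \<longlonglongrightarrow> Ln (z + of_real v)"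
    proof (cases "v > y")
      case True
      then show ?thesis by (intro tendsto_Ln Xv) (auto simp: zv complex_nonpos_Reals_iff)
    next
      case False
      then have "z \<noteq> 0" using v by (auto simp: zy)
      then have im: "\<And>n. Im (X n + of_real v) \<ge> 0" using side by simp
      have "(\<lambda>n. Ln (- \<i> * (X n + of_real v)) + \<i> * of_real pi / 2) \<longlonglongrightarrow>
            Ln (- \<i> * (z + of_real v)) + \<i> * of_real pi / 2"
        using False v by (intro tendsto_intros Xv) (auto simp: zv complex_nonpos_Reals_iff)
      also have "Ln (- \<i> * (z + of_real v)) + \<i> * of_real pi / 2 = Ln (z + of_real v)"
        by (rule Ln_eq_rotated[symmetric]) (use nz in \<open>auto simp: zv\<close>)
      finally show ?thesis
      proof (rule Lim_transform_eventually)
        have "eventually (\<lambda>n. X n + of_real v \<noteq> 0) sequentially"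
          using tendsto_imp_eventually_ne[OF Xv nz] .
        then show "\<forall>\<^sub>F n in sequentially. Ln (- \<i> * (X n + of_real v)) + \<i> * of_real pi / 2
                     = Ln (X n + of_real v)"
          by eventually_elim (use im Ln_eq_rotated in auto)
      qed
    qed
    then have "(\<lambda>n. exp ((s - 1) * Ln (X n + of_real v))) \<longlonglongrightarrow> exp ((s - 1) * Ln (z + of_real v))"
      by (intro tendsto_exp tendsto_mult[OF tendsto_const])
    moreover have "eventually (\<lambda>n. exp ((s - 1) * Ln (X n + of_real v)) = (X n + of_real v) powr (s - 1))
        sequentially"
      using tendsto_imp_eventually_ne[OF Xv nz] by eventually_elim (simp add: powr_def)
    ultimately have "(\<lambda>n. (X n + of_real v) powr (s - 1)) \<longlonglongrightarrow> exp ((s - 1) * Ln (z + of_real v))"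
      by (rule Lim_transform_eventually)
    also have "exp ((s - 1) * Ln (z + of_real v)) = (z + of_real v) powr (s - 1)"
      using nz by (simp add: powr_def)
    finally have "(\<lambda>n. (X n + of_real v) powr (s - 1)) \<longlonglongrightarrow> (z + of_real v) powr (s - 1)" .
    then show ?thesis unfolding f_def by (rule tendsto_mult) (intro tendsto_intros lim)
  qed
  have ae: "AE v in lborel. v \<noteq> y" by (rule AE_lborel_singleton)
  have "(\<lambda>n. LINT v|lborel. indicator {0<..} v *\<^sub>R f (X n) v) \<longlonglongrightarrow>
        (LINT v|lborel. indicator {0<..} v *\<^sub>R f z v)"
  proof (rule integral_dominated_convergence[OF _ _ W[unfolded set_integrable_def]])
    show "AE v in lborel. (\<lambda>n. indicator {0<..} v *\<^sub>R f (X n) v) \<longlonglongrightarrow> indicator {0<..} v *\<^sub>R f z v"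
      using ae by eventually_elim (use ptw in \<open>auto simp: indicator_def\<close>)
    show "AE v in lborel. norm (indicator {0<..} v *\<^sub>R f (X n) v) \<le> indicator {0<..} v *\<^sub>R W v" for n
      using ae by eventually_elim (use bound in \<open>auto simp: indicator_def\<close>)
  qed measurable
  then show ?thesis
    unfolding upper_Gamma_integral_def set_lebesgue_integral_def f_def .
qed

text \<open>
For \<open>Re m > 0\<close> the factor \<open>exp (- Re u)\<close> of the bound decays. For \<open>Re m = 0\<close> it is constant and the
decay comes from \<open>|u| ^ (Re s - 1)\<close> alone, hence the condition on \<open>Re s\<close>.
\<close>
lemma upper_Gamma_integral_tendsto_0:
  fixes z m s :: complex
  assumes m: "Re m > 0 \<or> (Re m = 0 \<and> m \<noteq> 0 \<and> Re s < 1)"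
  shows "((\<lambda>x::real. upper_Gamma_integral s (z + m * of_real x)) \<longlongrightarrow> 0) at_top"
proof -
  define u where "u = (\<lambda>x::real. z + m * of_real x)"
  define r where "r = Re s - 1"
  have m0: "m \<noteq> 0" using m by auto
  have norm_ge: "norm m * x - norm z \<le> norm (u x)" if "x \<ge> 0" for x
    using norm_triangle_ineq4[of "u x" z] that by (simp add: u_def norm_mult)
  have "filterlim (\<lambda>x. norm m * x - norm z) at_top at_top"
    using m0 by real_asymp
  then have norm_top: "filterlim (\<lambda>x. norm (u x)) at_top at_top"
    by (rule filterlim_at_top_mono) (use norm_ge in \<open>auto intro: eventually_mono[OF eventually_ge_at_top[of 0]]\<close>)
  have gap: "\<forall>\<^sub>F x in at_top. \<forall>v>0. 1 / 2 * norm (u x) \<le> norm (u x + of_real v)"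
  proof (cases "Re m > 0")
    case True
    have "filterlim (\<lambda>x. Re z + Re m * x) at_top at_top" using True by real_asymp
    then have "\<forall>\<^sub>F x in at_top. Re (u x) \<ge> 0" by (simp add: u_def filterlim_at_top)
    then show ?thesis
    proof eventually_elim
      case (elim x)
      show ?case
      proof (intro allI impI)
        fix v :: real assume "v > 0"
        then have "\<bar>Re (u x)\<bar> \<le> \<bar>Re (u x + of_real v)\<bar>" using elim by simp
        then have "norm (u x) \<le> norm (u x + of_real v)"
          unfolding cmod_def by (intro real_sqrt_le_mono add_mono abs_le_square_iff[THEN iffD1]) simp_all
        then show "1 / 2 * norm (u x) \<le> norm (u x + of_real v)"
          using norm_ge_zero[of "u x"] by linarith
      qed
    qed
  next
    case False
    then have Re: "Re (u x) = Re z" for x using m by (simp add: u_def)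
    have "\<forall>\<^sub>F x in at_top. norm (u x) \<ge> 2 * \<bar>Re z\<bar>"
      using norm_top by (simp add: filterlim_at_top)
    then show ?thesis
    proof eventually_elim
      case (elim x)
      have "norm (u x) \<le> \<bar>Re z\<bar> + \<bar>Im (u x)\<bar>" using cmod_le[of "u x"] Re by simp
      then have "1 / 2 * norm (u x) \<le> \<bar>Im (u x)\<bar>" using elim by simp
      also have "\<bar>Im (u x)\<bar> \<le> norm (u x + of_real v)" for v
        using abs_Im_le_cmod[of "u x + of_real v"] by simp
      finally show ?case by blast
    qed
  qed
  obtain C where C: "\<And>u. 1 \<le> norm u \<Longrightarrow> (\<And>v. v > 0 \<Longrightarrow> 1 / 2 * norm u \<le> norm (u + of_real v)) \<Longrightarrow>
      norm (upper_Gamma_integral s u) \<le> C * (norm u powr r * exp (- Re u))"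
    unfolding r_def by (rule upper_Gamma_integral_norm_le[of "1 / 2" s]) auto
  have "((\<lambda>x. norm (u x) powr r * exp (- Re (u x))) \<longlongrightarrow> 0) at_top"
  proof (cases "Re m > 0")
    case False
    then have "r < 0" and Re: "\<And>x. Re (u x) = Re z" using m by (simp_all add: r_def u_def)
    from tendsto_neg_powr[OF this(1) norm_top]
    show ?thesis unfolding Re by (rule tendsto_mult_left_zero)
  next
    case True
    define K where "K = norm z + norm m"
    have K: "K > 0" using m0 by (simp add: K_def add_nonneg_pos)
    show ?thesis
    proof (rule Lim_null_comparison)
      show "\<forall>\<^sub>F x in at_top. norm (norm (u x) powr r * exp (- Re (u x)))
              \<le> (K * x) powr \<bar>r\<bar> * exp (- (Re z + Re m * x))"
        using eventually_ge_at_top[of 1] filterlim_at_top[THEN iffD1, OF norm_top, rule_format, of 1]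
      proof eventually_elim
        case (elim x)
        have "norm (u x) \<le> norm z + norm m * x"
          using norm_triangle_ineq[of z "m * of_real x"] elim by (simp add: u_def norm_mult)
        also have "\<dots> \<le> K * x"
          using elim mult_left_mono[of 1 x "norm z"] by (simp add: K_def algebra_simps)
        finally have "norm (u x) powr r \<le> (K * x) powr \<bar>r\<bar>"
          using elim by (intro order_trans[OF powr_mono powr_mono2, of r "\<bar>r\<bar>"]) auto
        then show ?case by (simp add: u_def mult_right_mono)
      qed
      show "((\<lambda>x. (K * x) powr \<bar>r\<bar> * exp (- (Re z + Re m * x))) \<longlongrightarrow> 0) at_top"
        using True K by real_asymp
    qed
  qed
  from tendsto_mult_right_zero[OF this, of C]
  have "((\<lambda>x. C * (norm (u x) powr r * exp (- Re (u x)))) \<longlongrightarrow> 0) at_top" .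
  then have "((\<lambda>x. upper_Gamma_integral s (u x)) \<longlongrightarrow> 0) at_top"
  proof (rule Lim_null_comparison[rotated])
    show "\<forall>\<^sub>F x in at_top. norm (upper_Gamma_integral s (u x))
            \<le> C * (norm (u x) powr r * exp (- Re (u x)))"
      using gap filterlim_at_top[THEN iffD1, OF norm_top, rule_format, of 1]
      by eventually_elim (intro C, auto)
  qed
  then show ?thesis by (simp add: u_def)
qed

section \<open>The analytic continuation in the exponent\<close>

text \<open>
On the left half plane, \<open>log (-u) + i \<pi>\<close> continues the principal logarithm of the upper half plane
across the cut. A primitive \<open>P\<close> of the integrand with this logarithm is continuous at \<open>z\<close>, and in the
upper left quadrant it differs from \<open>-\<Gamma>(s, u)\<close> by a constant.
\<close>
lemma upper_Gamma_integral_limit_at_cut: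
  fixes z s :: complex
  assumes z: "Re z < 0" "Im z = 0"
  shows "\<exists>l. (upper_Gamma_integral s \<longlongrightarrow> l) (at z within {u. Im u > 0})"
proof -
  define g where "g = (\<lambda>u. exp ((s - 1) * (Ln (- u) + \<i> * of_real pi)) * exp (- u))"
  define Q where "Q = {u. Re u < 0} \<inter> {u. Im u > 0}"
  have "g holomorphic_on {u. Re u < 0}"
    unfolding g_def by (intro holomorphic_intros) (auto simp: complex_nonpos_Reals_iff)
  then obtain P where P: "\<And>u. u \<in> {u. Re u < 0} \<Longrightarrow> (P has_field_derivative g u) (at u within {u. Re u < 0})"
    using holomorphic_convex_primitive'[OF convex_halfspace_Re_lt open_halfspace_Re_lt] by metis
  then have P: "(P has_field_derivative g u) (at u)" if "Re u < 0" for u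
    using that at_within_open[OF _ open_halfspace_Re_lt, of u 0] by fastforce
  have "\<exists>c. \<forall>u\<in>Q. upper_Gamma_integral s u + P u = c"
  proof (rule has_field_derivative_zero_constant)
    show "convex Q" unfolding Q_def
      by (intro convex_Int convex_halfspace_Re_lt convex_halfspace_Im_gt)
    fix u assume u: "u \<in> Q"
    then have "Ln (- u) = Ln u - \<i> * of_real pi" by (subst Ln_minus) (auto simp: Q_def)
    then have "g u = u powr (s - 1) * exp (- u)" using u by (auto simp: g_def powr_def Q_def)
    then have "((\<lambda>u. upper_Gamma_integral s u + P u) has_field_derivative 0) (at u)"
      using u by (auto intro!: derivative_eq_intros P has_field_derivative_upper_Gamma_integral
                       simp: Q_def complex_nonpos_Reals_iff)
    then show "((\<lambda>u. upper_Gamma_integral s u + P u) has_field_derivative 0) (at u within Q)"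
      by (rule has_field_derivative_at_within)
  qed
  then obtain c where c: "\<And>u. u \<in> Q \<Longrightarrow> upper_Gamma_integral s u + P u = c" by blast
  have "isCont P z" using P[OF z(1)] by (rule DERIV_isCont)
  then have "(P \<longlongrightarrow> P z) (at z within {u. Im u > 0})"
    unfolding isCont_def by (rule tendsto_within_subset) auto
  then have "((\<lambda>u. c - P u) \<longlongrightarrow> c - P z) (at z within {u. Im u > 0})"
    by (intro tendsto_intros)
  moreover have "\<forall>\<^sub>F u in at z within {u. Im u > 0}. c - P u = upper_Gamma_integral s u"
  proof -
    have "\<forall>\<^sub>F u in nhds z. Re u < 0"
      using z by (intro eventually_nhds_in_open[of "{u. Re u < 0}", simplified] open_halfspace_Re_lt)
    then have "\<forall>\<^sub>F u in at z within {u. Im u > 0}. Re u < 0"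
      unfolding eventually_at_filter by (auto elim: eventually_mono)
    moreover have "\<forall>\<^sub>F u in at z within {u. Im u > 0}. Im u > 0"
      unfolding eventually_at_filter by auto
    ultimately show ?thesis
      by eventually_elim (use c in \<open>force simp: Q_def\<close>)
  qed
  ultimately show ?thesis by (blast intro: Lim_transform_eventually)
qed

lemma filterlim_at_within_upper_half_plane:
  fixes f :: "'a \<Rightarrow> complex"
  assumes "(f \<longlongrightarrow> z) F" "\<forall>\<^sub>F x in F. Im (f x) > 0" "Im z = 0"
  shows "filterlim f (at z within {u. Im u > 0}) F"
  unfolding filterlim_at using assms by (auto elim!: eventually_mono)

text \<open>
The ray in the direction \<open>1 + i\<close> leaves the cut at once and never comes close to \<open>0\<close>, so
\<open>-\<Gamma>(s, u)\<close> is a primitive along it, with limit \<open>-l\<close> at the start and \<open>0\<close> at infinity. In contrast to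
the horizontal ray, this represents the limit by a convergent integral for every \<open>s\<close>.
\<close>
lemma upper_Gamma_integral_limit_eq_ray:
  fixes z s l :: complex
  assumes z: "Re z < 0" "Im z = 0"
      and l: "(upper_Gamma_integral s \<longlongrightarrow> l) (at z within {u. Im u > 0})"
  shows "(1 + \<i>) * (LBINT v:{0<..}. (z + (1 + \<i>) * of_real v) powr (s - 1)
            * exp (- (z + (1 + \<i>) * of_real v))) = l"
    and "v > 0 \<Longrightarrow> - Re z / 2 \<le> norm (z + (1 + \<i>) * of_real v)"
proof -
  have gap: "- Re z / 2 \<le> norm (z + (1 + \<i>) * of_real v)" if "v > 0" for v
  proof (cases "v \<ge> - Re z / 2")
    case True
    then show ?thesis using abs_Im_le_cmod[of "z + (1 + \<i>) * of_real v"] z that by simp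
  next
    case False
    then show ?thesis using abs_Re_le_cmod[of "z + (1 + \<i>) * of_real v"] z that by simp
  qed
  then show "v > 0 \<Longrightarrow> - Re z / 2 \<le> norm (z + (1 + \<i>) * of_real v)" .
  define u where "u = (\<lambda>v. z + (1 + \<i>) * complex_of_real v)"
  define f where "f = (\<lambda>v. (1 + \<i>) * (u v powr (s - 1) * exp (- u v)))"
  have u: "u v \<notin> \<real>\<^sub>\<le>\<^sub>0" if "v > 0" for v
    using that z by (auto simp: u_def complex_nonpos_Reals_iff)
  have int: "set_integrable lborel {0<..} f"
    unfolding f_def u_def
    by (intro set_integrable_mult_right ray_integrable[of "1 + \<i>" "- Re z / 2"] gap) (use z in auto)
  have F: "((\<lambda>v. - upper_Gamma_integral s (u v)) has_vector_derivative f v) (at v)" if "v > 0" for v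
  proof -
    have 1: "((\<lambda>w. - upper_Gamma_integral s (z + (1 + \<i>) * w)) has_field_derivative f v) (at (of_real v))"
      unfolding f_def u_def
      by (rule derivative_eq_intros DERIV_chain2[OF has_field_derivative_upper_Gamma_integral] refl
           u[OF that, unfolded u_def])+ (simp add: algebra_simps)
    show ?thesis using has_vector_derivative_real_field[OF 1] by (simp add: u_def)
  qed
  have cont: "isCont f v" if "v > 0" for v
    unfolding f_def u_def using u[OF that] by (intro continuous_intros) (auto simp: u_def)
  have "(LBINT v=ereal 0..\<infinity>. f v) = 0 - (- l)"
  proof (rule interval_integral_FTC_integrable[where F = "\<lambda>v. - upper_Gamma_integral s (u v)"])
    show "(((\<lambda>v. - upper_Gamma_integral s (u v)) \<circ> real_of_ereal) \<longlongrightarrow> - l) (at_right (ereal 0))"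
    proof -
      have "(u \<longlongrightarrow> u 0) (at_right 0)" unfolding u_def by (intro tendsto_intros)
      moreover have "\<forall>\<^sub>F v in at_right 0. Im (u v) > 0"
        using eventually_at_right_less[of 0] by eventually_elim (use z in \<open>simp add: u_def\<close>)
      ultimately have "filterlim u (at z within {u. Im u > 0}) (at_right 0)"
        using z by (intro filterlim_at_within_upper_half_plane) (simp_all add: u_def)
      from tendsto_minus[OF filterlim_compose[OF l this]]
      show ?thesis by (simp only: ereal_tendsto_simps1)
    qed
    have "((\<lambda>v. upper_Gamma_integral s (u v)) \<longlongrightarrow> 0) at_top"
      unfolding u_def by (rule upper_Gamma_integral_tendsto_0) simp
    from tendsto_minus[OF this]
    show "(((\<lambda>v. - upper_Gamma_integral s (u v)) \<circ> real_of_ereal) \<longlongrightarrow> 0) (at_left \<infinity>)"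
      by (simp add: ereal_tendsto_simps1)
  qed (use F cont int in auto)
  then have "(LBINT v:{0<..}. f v) = l"
    by (simp add: interval_integral_to_infinity_eq)
  then show "(1 + \<i>) * (LBINT v:{0<..}. (z + (1 + \<i>) * of_real v) powr (s - 1)
            * exp (- (z + (1 + \<i>) * of_real v))) = l"
    by (simp add: f_def u_def)
qed

lemma upper_Gamma_integral_limit_along_sequence_above:
  fixes s z :: complex
  assumes s: "Re s > 0" and z: "Im z = 0" "Re z \<le> 0"
  obtains X where "X \<longlonglongrightarrow> z" "\<And>n. Im (X n) > 0"
    "(\<lambda>n. upper_Gamma_integral s (X n)) \<longlonglongrightarrow> upper_Gamma_integral s z"
proof -
  define X where "X = (\<lambda>n. z + \<i> * of_real (inverse (real (Suc n))))"
  have "X \<longlonglongrightarrow> z + \<i> * of_real 0"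
    unfolding X_def by (intro tendsto_intros LIMSEQ_inverse_real_of_nat)
  then have X: "X \<longlonglongrightarrow> z" by simp
  have Im: "Im (X n) > 0" for n using z by (simp add: X_def)
  have "(\<lambda>n. upper_Gamma_integral s (X n)) \<longlonglongrightarrow> upper_Gamma_integral s z"
  proof (rule upper_Gamma_integral_tendsto_boundary[OF s z X zero_less_one])
    fix n :: nat and v :: real
    have "norm (z + of_real v) = \<bar>Re (X n + of_real v)\<bar>"
      using z by (simp add: X_def cmod_eq_Re)
    then show "1 * norm (z + of_real v) \<le> norm (X n + of_real v)"
      using abs_Re_le_cmod[of "X n + of_real v"] by simp
  qed (use Im in \<open>auto intro: less_imp_le\<close>)
  from that[OF X Im this] show ?thesis .
qed

lemma upper_Gamma_integral_limit_from_above: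
  fixes z s l :: complex
  assumes z: "Re z < 0" "Im z = 0" and s: "Re s > 0"
      and l: "(upper_Gamma_integral s \<longlongrightarrow> l) (at z within {u. Im u > 0})"
  shows "l = upper_Gamma_integral s z"
proof -
  obtain X where X: "X \<longlonglongrightarrow> z" "\<And>n. Im (X n) > 0"
    "(\<lambda>n. upper_Gamma_integral s (X n)) \<longlonglongrightarrow> upper_Gamma_integral s z"
    by (rule upper_Gamma_integral_limit_along_sequence_above[OF s z(2) less_imp_le[OF z(1)]]) blast
  have "filterlim X (at z within {u. Im u > 0}) sequentially"
    using X(1,2) z by (intro filterlim_at_within_upper_half_plane) auto
  from filterlim_compose[OF l this] show ?thesis
    using LIMSEQ_unique X(3) by blast
qed

lemma connected_upper_Gamma_domain:
  "connected (if z = (0::complex) then - \<int>\<^sub>\<le>\<^sub>0 else UNIV :: complex set)"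
proof -
  have "countable (\<int>\<^sub>\<le>\<^sub>0 :: complex set)"
    by (rule countable_subset[of _ "range of_int"]) (auto elim!: nonpos_Ints_cases)
  then have "connected (UNIV - \<int>\<^sub>\<le>\<^sub>0 :: complex set)"
    by (intro connected_open_diff_countable) auto
  then show ?thesis by (auto simp: Compl_eq_Diff_UNIV intro: connected_UNIV)
qed

text \<open>
Identity theorem: two admissible continuations agree on the half plane \<open>Re s > 0\<close>, hence on the
connected domain of definition.
\<close>
lemma upper_Gamma_eqI:
  assumes "g holomorphic_on (if z = 0 then - \<int>\<^sub>\<le>\<^sub>0 else UNIV)"
      and "\<And>w. Re w > 0 \<Longrightarrow> g w = upper_Gamma_integral w z"
      and "s \<in> (if z = 0 then - \<int>\<^sub>\<le>\<^sub>0 else UNIV)"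
  shows "upper_Gamma s z = g s"
proof -
  define D where "D = (if z = (0::complex) then - \<int>\<^sub>\<le>\<^sub>0 else UNIV :: complex set)"
  define Q where "Q = (\<lambda>g. g holomorphic_on D \<and> (\<forall>w. Re w > 0 \<longrightarrow> g w = upper_Gamma_integral w z))"
  have "Q g" using assms by (simp add: Q_def D_def)
  moreover define G where "G = (SOME g. Q g)"
  ultimately have Q: "Q G" by (simp add: someI[of Q g])
  have "G s = g s"
  proof (rule analytic_continuation_open[of "{w. Re w > 0}" D G g])
    show "connected D" unfolding D_def by (rule connected_upper_Gamma_domain)
    show "{w. 0 < Re w} \<subseteq> D" by (auto simp: D_def elim!: nonpos_Ints_cases)
    show "{w. 0 < Re w} \<noteq> {}" by (auto intro: exI[of _ 1])
  qed (use Q \<open>Q g\<close> assms(3) in \<open>simp_all add: Q_def D_def open_halfspace_Re_gt open_Compl\<close>)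
  then show ?thesis by (simp add: upper_Gamma_def G_def Q_def D_def)
qed

lemma upper_Gamma_eq_integral_off_cut:
  fixes z :: complex
  assumes z: "z \<notin> \<real>\<^sub>\<le>\<^sub>0"
  shows "upper_Gamma s z = upper_Gamma_integral s z"
proof (rule upper_Gamma_eqI)
  obtain c where "c > 0" "\<And>v. v > 0 \<Longrightarrow> c \<le> norm (z + of_real v)"
    using horizontal_ray_gap[OF z] by blast
  then have "(\<lambda>w. LBINT s:{0<..}. (z + 1 * of_real s) powr w * exp (- (z + 1 * of_real s)))
               holomorphic_on UNIV"
    by (intro ray_entire[of 1 c]) auto
  then have "((\<lambda>w. LBINT s:{0<..}. (z + 1 * of_real s) powr w * exp (- (z + 1 * of_real s)))
               \<circ> (\<lambda>w. w - 1)) holomorphic_on UNIV"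
    by (intro holomorphic_on_compose_gen[where t = UNIV] holomorphic_intros) auto
  also have "(\<lambda>w. LBINT s:{0<..}. (z + 1 * of_real s) powr w * exp (- (z + 1 * of_real s)))
               \<circ> (\<lambda>w. w - 1) = (\<lambda>w. upper_Gamma_integral w z)"
    by (simp add: upper_Gamma_integral_def fun_eq_iff)
  finally show "(\<lambda>w. upper_Gamma_integral w z) holomorphic_on (if z = 0 then - \<int>\<^sub>\<le>\<^sub>0 else UNIV)"
    by (rule holomorphic_on_subset) auto
qed (use z in auto)

lemma upper_Gamma_on_cut:
  fixes z :: complex
  assumes z: "Re z < 0" "Im z = 0"
  shows "(upper_Gamma_integral s \<longlongrightarrow> upper_Gamma s z) (at z within {u. Im u > 0})"
    and "Re s > 0 \<Longrightarrow> upper_Gamma s z = upper_Gamma_integral s z"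
proof -
  define E where "E = (\<lambda>w. (1 + \<i>) * (LBINT v:{0<..}. (z + (1 + \<i>) * of_real v) powr (w - 1)
            * exp (- (z + (1 + \<i>) * of_real v))))"
  have lim: "(upper_Gamma_integral w \<longlongrightarrow> E w) (at z within {u. Im u > 0})" for w
  proof -
    obtain l where l: "(upper_Gamma_integral w \<longlongrightarrow> l) (at z within {u. Im u > 0})"
      using upper_Gamma_integral_limit_at_cut[OF z] by blast
    with upper_Gamma_integral_limit_eq_ray(1)[OF z l] show ?thesis by (simp add: E_def)
  qed
  have gap: "- Re z / 2 \<le> norm (z + (1 + \<i>) * of_real v)" if "v > 0" for v
    using upper_Gamma_integral_limit_eq_ray(2)[OF z lim that] .
  have E_eq: "E w = upper_Gamma_integral w z" if "Re w > 0" for w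
    by (rule upper_Gamma_integral_limit_from_above[OF z that lim])
  have "(\<lambda>w. LBINT v:{0<..}. (z + (1 + \<i>) * of_real v) powr w
            * exp (- (z + (1 + \<i>) * of_real v))) holomorphic_on UNIV"
    using gap z by (intro ray_entire[of _ "- Re z / 2"]) auto
  then have "((\<lambda>w. LBINT v:{0<..}. (z + (1 + \<i>) * of_real v) powr w
            * exp (- (z + (1 + \<i>) * of_real v))) \<circ> (\<lambda>w. w - 1)) holomorphic_on UNIV"
    by (intro holomorphic_on_compose_gen[where t = UNIV] holomorphic_intros) auto
  then have "E holomorphic_on UNIV"
    unfolding E_def o_def by (intro holomorphic_intros)
  then have "upper_Gamma s z = E s"
    by (intro upper_Gamma_eqI E_eq) (use z in \<open>auto intro: holomorphic_on_subset\<close>)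
  then show "(upper_Gamma_integral s \<longlongrightarrow> upper_Gamma s z) (at z within {u. Im u > 0})"
    and "Re s > 0 \<Longrightarrow> upper_Gamma s z = upper_Gamma_integral s z"
    using lim E_eq by auto
qed

lemma upper_Gamma_integral_0:
  assumes "Re s > 0"
  shows "upper_Gamma_integral s 0 = Gamma s"
proof -
  have "set_integrable lebesgue {0<..} (\<lambda>t. complex_of_real t powr (s - 1) / of_real (exp t))"
    by (rule absolutely_integrable_Gamma_integral'[OF assms])
  then have "set_integrable lborel {0<..} (\<lambda>t. complex_of_real t powr (s - 1) / of_real (exp t))"
    unfolding set_integrable_def by (subst (asm) integrable_completion) measurable
  from set_borel_integral_eq_integral(2)[OF this] Gamma_integral_complex'[OF assms]
  have "(LBINT t:{0<..}. complex_of_real t powr (s - 1) / of_real (exp t)) = Gamma s"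
    by (simp add: integral_unique)
  then show ?thesis
    by (simp add: upper_Gamma_integral_def exp_minus exp_of_real divide_inverse)
qed

lemma upper_Gamma_eq_integral:
  assumes s: "Re s > 0"
  shows "upper_Gamma s z = upper_Gamma_integral s z"
proof (cases "z = 0")
  case True
  have "upper_Gamma s z = Gamma s"
  proof (rule upper_Gamma_eqI)
    show "Gamma holomorphic_on (if z = 0 then - \<int>\<^sub>\<le>\<^sub>0 else UNIV)"
      using True by (auto intro!: holomorphic_intros)
    show "s \<in> (if z = 0 then - \<int>\<^sub>\<le>\<^sub>0 else UNIV)" using True s by (auto elim!: nonpos_Ints_cases)
  qed (use True upper_Gamma_integral_0 in simp)
  then show ?thesis using True s by (simp add: upper_Gamma_integral_0)
next
  case nz: False
  show ?thesis
  proof (cases "z \<in> \<real>\<^sub>\<le>\<^sub>0")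
    case True
    then have "Re z < 0" "Im z = 0" using nz by (auto simp: complex_nonpos_Reals_iff complex_eq_iff)
    then show ?thesis using upper_Gamma_on_cut(2) s by blast
  qed (rule upper_Gamma_eq_integral_off_cut)
qed

section \<open>Arguments under real translations\<close>

text \<open>
With \<open>\<alpha>\<close> and \<open>\<beta>\<close> the two arguments, \<open>|z| |z + r| sin (\<beta> - \<alpha>) = - r Im z < 0\<close>.
\<close>
lemma Arg_add_of_real_less:
  assumes "Im z > 0" "r > 0"
  shows "Arg (z + of_real r) < Arg z"
proof (rule ccontr)
  define \<alpha> \<beta> where "\<alpha> = Arg z" and "\<beta> = Arg (z + of_real r)"
  assume "\<not> ?thesis"
  moreover have "0 < \<alpha>" "\<alpha> < pi" "0 < \<beta>" "\<beta> < pi"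
    using assms Arg_lt_pi[of z] Arg_lt_pi[of "z + of_real r"] by (auto simp: \<alpha>_def \<beta>_def)
  ultimately have "sin (\<beta> - \<alpha>) \<ge> 0" by (intro sin_ge_zero) (auto simp: \<alpha>_def \<beta>_def)
  then have "norm z * norm (z + of_real r) * sin (\<beta> - \<alpha>) \<ge> 0" by simp
  also have "norm z * norm (z + of_real r) * sin (\<beta> - \<alpha>)
      = (norm (z + of_real r) * sin \<beta>) * (norm z * cos \<alpha>)
        - (norm (z + of_real r) * cos \<beta>) * (norm z * sin \<alpha>)"
    by (simp add: sin_diff algebra_simps)
  also have "\<dots> = Im (z + of_real r) * Re z - Re (z + of_real r) * Im z"
    unfolding \<alpha>_def \<beta>_def Re_rcis[symmetric] Im_rcis[symmetric] rcis_cmod_Arg ..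
  also have "\<dots> = - r * Im z" by (simp add: algebra_simps)
  finally show False using mult_pos_pos[OF assms(2,1)] by simp
qed

lemma Arg_add_of_real_greater:
  assumes "Im z < 0" "r > 0"
  shows "Arg z < Arg (z + of_real r)"
proof -
  have "z \<notin> \<real>" "z + of_real r \<notin> \<real>" using assms by (auto simp: complex_is_Real_iff)
  moreover have "Arg (cnj z + of_real r) < Arg (cnj z)"
    using assms by (intro Arg_add_of_real_less) auto
  ultimately show ?thesis using Arg_cnj[of z] Arg_cnj[of "z + of_real r"] by simp
qed

text \<open>
The \<open>n\<close>-th term of the series has \<open>m + n\<close> in place of \<open>m\<close>. Its argument lies between \<open>0\<close> and
\<open>Arg m\<close>, and \<open>Arg (log a)\<close> is negative if and only if \<open>Arg a\<close> is.
\<close>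
lemma consistent_branches_add_nat:
  assumes c: "consistent_branches k a m" and m: "Re m \<ge> 0" "m \<noteq> 0" and a: "a \<noteq> 0"
  shows "consistent_branches k a (m + of_nat n)"
proof (cases "n = 0")
  case False
  then have n: "real n > 0" by simp
  have sh: "m + of_nat n = m + of_real (real n)" by simp
  define A where "A = Arg (Ln a)"
  have pos: "Arg (m + of_nat n) > 0" if "Arg m > 0"
    using that m Arg_pos_iff[of m] Arg_pos_iff[of "m + of_nat n"] by auto
  have le: "Arg (m + of_nat n) \<le> Arg m" if "Arg m \<ge> 0"
  proof (cases "Im m = 0")
    case True
    then have "Arg (m + of_nat n) = 0" using m by (auto simp: Arg_eq_0 complex_is_Real_iff)
    then show ?thesis using that by simp
  next
    case False
    then have "Im m > 0" using that by (simp add: Arg_less_0)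
    then show ?thesis unfolding sh using Arg_add_of_real_less[OF _ n, of m] by simp
  qed
  have nn: "Arg (m + of_nat n) \<ge> 0" if "Arg m \<ge> 0" using that by (simp add: Arg_less_0)
  have ge: "Arg (m + of_nat n) \<ge> Arg m" if "Arg m < 0"
    unfolding sh using that Arg_add_of_real_greater[OF _ n, of m] by (simp add: Arg_neg_iff)
  have neg: "Arg (m + of_nat n) < 0" if "Arg m < 0" using that by (simp add: Arg_neg_iff)
  consider "k \<in> \<nat>" | "0 \<le> Arg a" "a = 1" | "0 \<le> Arg a" "0 < Arg m + A"
    | "k \<in> \<int>" "Arg a < 0" "Arg m + A \<le> 0"
    using c unfolding consistent_branches_def A_def by blast
  then show ?thesis
  proof cases
    case 3
    have "A \<ge> 0" using 3 a by (simp add: A_def Arg_less_0 Arg_eq_Im_Ln[symmetric])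
    then have "0 < Arg (m + of_nat n) + A"
      using 3 pos nn ge by (smt (verit))
    then show ?thesis using 3 unfolding consistent_branches_def A_def by blast
  next
    case 4
    have "A < 0" using 4 a by (simp add: A_def Arg_neg_iff Arg_eq_Im_Ln[symmetric])
    then have "Arg (m + of_nat n) + A \<le> 0" using 4 le neg by (smt (verit))
    then show ?thesis using 4 unfolding consistent_branches_def A_def by blast
  qed (auto simp: consistent_branches_def)
qed (use c in simp)

lemma Ln_times_real:
  assumes "a \<noteq> 0" "x > 0"
  shows "Ln (a * of_real x) = Ln a + of_real (ln x)"
  using Ln_times_of_real[OF assms(2,1)] Ln_of_real[OF assms(2)] by (simp add: mult.commute add.commute)

section \<open>Restrictions on the exponents from integrability\<close>

text \<open>
The increments of \<open>g\<close> are at most the integral of \<open>|f|\<close>. So the derivative of an unbounded function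
is not integrable.
\<close>
lemma bounded_primitive:
  fixes f g :: "real \<Rightarrow> real"
  assumes int: "set_integrable lborel {l<..<r} f"
      and g: "\<And>x. l < x \<Longrightarrow> x < r \<Longrightarrow> (g has_real_derivative f x) (at x)"
  obtains B where "\<And>x. l < x \<Longrightarrow> x < r \<Longrightarrow> \<bar>g x\<bar> \<le> B"
proof -
  define J where "J = (LBINT x:{l<..<r}. \<bar>f x\<bar>)"
  have abs: "set_integrable lborel {l<..<r} (\<lambda>x. \<bar>f x\<bar>)" using int by (rule set_integrable_abs)
  have step: "\<bar>g y - g x\<bar> \<le> J" if xy: "l < x" "x \<le> y" "y < r" for x y
  proof -
    have "(f has_integral (g y - g x)) {x..y}"
      using xy g by (intro fundamental_theorem_of_calculus)
        (auto simp: has_real_derivative_iff_has_vector_derivative[symmetric] intro: has_field_derivative_at_within)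
    moreover have i: "set_integrable lborel {x..y} f"
      by (rule set_integrable_subset[OF int]) (use xy in auto)
    ultimately have "g y - g x = (LBINT x:{x..y}. f x)"
      by (simp add: set_borel_integral_eq_integral(2) integral_unique)
    also have "\<bar>\<dots>\<bar> \<le> (LBINT x:{x..y}. \<bar>f x\<bar>)"
      using set_integral_norm_bound[OF i] by simp
    also have "\<dots> \<le> J"
      unfolding J_def set_lebesgue_integral_def
      using set_integrable_abs[OF i] abs xy unfolding set_integrable_def
      by (intro integral_mono) (auto simp: indicator_def)
    finally show ?thesis .
  qed
  define x0 where "x0 = (l + r) / 2"
  show ?thesis
  proof (rule that[of "\<bar>g x0\<bar> + J"])
    fix x assume x: "l < x" "x < r"
    then have "\<bar>g x - g x0\<bar> \<le> J"
      using step[of x x0] step[of x0 x] by (cases "x \<le> x0") (auto simp: x0_def)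
    then show "\<bar>g x\<bar> \<le> \<bar>g x0\<bar> + J" by linarith
  qed
qed

lemma log_log_bounded_if_integrable:
  fixes p l r :: real
  assumes p: "0 \<le> l" "r \<le> p"
      and int: "set_integrable lborel {l<..<r} (\<lambda>x. 1 / (x * (ln p - ln x)))"
  obtains B where "\<And>x. l < x \<Longrightarrow> x < r \<Longrightarrow> \<bar>ln (ln p - ln x)\<bar> \<le> B"
proof -
  have "((\<lambda>x. - ln (ln p - ln x)) has_real_derivative 1 / (x * (ln p - ln x))) (at x)"
    if "l < x" "x < r" for x
    using that p by (auto intro!: derivative_eq_intros simp: field_simps)
  from bounded_primitive[OF int this] that show ?thesis by (metis abs_minus_cancel)
qed

text \<open>
Otherwise the absolute value of the integrand would be at least a multiple of \<open>1 / (x |log x|)\<close>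
near \<open>0\<close>, the derivative of the unbounded function \<open>- log |log x|\<close>.
\<close>
lemma exponent_conditions_at_0:
  fixes k a m :: complex
  assumes a: "a \<noteq> 0"
      and int: "set_integrable lborel {0<..<1}
                  (\<lambda>x. of_real x powr (- 1 + m) * Ln (a * of_real x) powr k)"
  shows "Re m > 0 \<or> (Re m = 0 \<and> Re k < - 1)"
proof (rule ccontr)
  define h where "h = (\<lambda>x::real. of_real x powr (- 1 + m) * Ln (a * of_real x) powr k)"
  define E where "E = exp (- (pi * \<bar>Im k\<bar>)) * 2 powr (- \<bar>Re k\<bar>)"
  assume "\<not> ?thesis"
  then have mk: "Re m < 0 \<or> Re m = 0 \<and> Re k \<ge> - 1" by auto
  have E: "E > 0" by (simp add: E_def)
  \<comment> \<open>Dividing by \<open>x |log x|\<close> gives \<open>x ^ (Re m - 1) |log x| ^ Re k \<ge> 1 / (x |log x|)\<close>.\<close>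
  have "\<forall>\<^sub>F x in at_right 0. x powr Re m * (- ln x) powr (Re k + 1) \<ge> 1"
  proof (cases "Re m < 0")
    case True
    then have "filterlim (\<lambda>x. x powr Re m * (- ln x) powr (Re k + 1)) at_top (at_right 0)"
      by real_asymp
    then show ?thesis by (simp add: filterlim_at_top)
  next
    case False
    have "\<forall>\<^sub>F x::real in at_right 0. - ln x \<ge> 1" by real_asymp
    moreover have "\<forall>\<^sub>F x::real in at_right 0. x > 0" by (rule eventually_at_right_less)
    ultimately show ?thesis
      by eventually_elim (use False mk in \<open>auto intro: ge_one_powr_ge_zero\<close>)
  qed
  moreover have "\<forall>\<^sub>F x::real in at_right 0. - ln x \<ge> 2 * norm (Ln a) + 1" by real_asymp
  moreover have "\<forall>\<^sub>F x::real in at_right 0. x < 1" by real_asymp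
  ultimately have "\<forall>\<^sub>F x in at_right 0. x < 1 \<and> - ln x \<ge> 2 * norm (Ln a) + 1 \<and>
      x powr Re m * (- ln x) powr (Re k + 1) \<ge> 1"
    by eventually_elim auto
  then obtain \<delta> where \<delta>: "\<delta> > 0" and ev: "\<And>x. 0 < x \<Longrightarrow> x < \<delta> \<Longrightarrow>
      x < 1 \<and> - ln x \<ge> 2 * norm (Ln a) + 1 \<and> x powr Re m * (- ln x) powr (Re k + 1) \<ge> 1"
    by (auto simp: eventually_at_right_field)
  define d where "d = min \<delta> 1"
  have d: "0 < d" "d \<le> 1" using \<delta> by (auto simp: d_def)
  have bound: "1 / (x * (ln 1 - ln x)) \<le> norm (of_real (1 / E) * h x)" if x: "0 < x" "x < d" for x
  proof -
    define y where "y = - ln x"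
    have x': "x < 1" "y \<ge> 2 * norm (Ln a) + 1" "x powr Re m * y powr (Re k + 1) \<ge> 1"
      using ev[of x] x by (auto simp: d_def y_def)
    have y: "y > 0" using x' norm_ge_zero[of "Ln a"] by linarith
    define L where "L = Ln (a * of_real x)"
    have L: "L = Ln a - of_real y" unfolding L_def y_def using x by (subst Ln_times_real[OF a]) auto
    have "norm L \<ge> y / 2" "norm L \<le> 2 * y"
      using norm_triangle_ineq4[of "Ln a" "of_real y"] norm_triangle_ineq2[of "of_real y" "Ln a"]
        x' y norm_minus_commute[of "of_real y" "Ln a"] unfolding L norm_of_real by simp_all
    then have t: "1 / 2 \<le> norm L / y" "norm L / y \<le> 2" using y by (auto simp: field_simps)
    have "2 powr (- \<bar>Re k\<bar>) \<le> (norm L / y) powr Re k"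
    proof (cases "Re k \<ge> 0")
      case True
      then have "(1 / 2) powr Re k \<le> (norm L / y) powr Re k" using t by (intro powr_mono2) auto
      then show ?thesis using True by (simp add: powr_divide powr_minus field_simps)
    next
      case False
      have pos: "0 < norm L / y" using t by linarith
      have "2 powr Re k \<le> (norm L / y) powr Re k"
        by (rule powr_mono2'[OF _ pos t(2)]) (use False in simp)
      then show ?thesis using False by simp
    qed
    then have "2 powr (- \<bar>Re k\<bar>) * y powr Re k \<le> (norm L / y) powr Re k * y powr Re k"
      by (rule mult_right_mono) auto
    also have "\<dots> = norm L powr Re k" using y by (simp add: powr_mult[symmetric])
    finally have "exp (- (pi * \<bar>Im k\<bar>)) * (2 powr (- \<bar>Re k\<bar>) * y powr Re k)
        \<le> exp (- (pi * \<bar>Im k\<bar>)) * norm L powr Re k"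
      by (rule mult_left_mono) auto
    also have "\<dots> \<le> norm (L powr k)" using norm_powr_ge[of L k] by (simp add: mult.commute)
    finally have "E * y powr Re k \<le> norm (L powr k)" by (simp add: E_def mult_ac)
    then have "y powr Re k \<le> norm (L powr k) / E" using E by (simp add: field_simps)
    then have "x powr (Re m - 1) * y powr Re k \<le> x powr (Re m - 1) * (norm (L powr k) / E)"
      by (rule mult_left_mono) auto
    also have "\<dots> = norm (of_real (1 / E) * h x)"
      using x E by (simp add: h_def L_def norm_mult norm_divide norm_powr_real_powr)
    finally have 1: "x powr (Re m - 1) * y powr Re k \<le> norm (of_real (1 / E) * h x)" .
    have "1 / (x * y) \<le> (x powr Re m * y powr (Re k + 1)) / (x * y)"
      using x' x y by (intro divide_right_mono) auto
    also have "\<dots> = x powr (Re m - 1) * y powr Re k"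
      using x y by (simp add: powr_diff powr_add)
    finally show ?thesis using 1 by (simp add: y_def)
  qed
  have "set_integrable lborel {0<..<d} (\<lambda>x. of_real (1 / E) * h x)"
    by (intro set_integrable_mult_right set_integrable_subset[OF int[folded h_def]]) (use d in auto)
  then have "set_integrable lborel {0<..<d} (\<lambda>x. 1 / (x * (ln 1 - ln x)))"
  proof (rule set_integrable_bound)
    show "set_borel_measurable lborel {0<..<d} (\<lambda>x. 1 / (x * (ln 1 - ln x)))"
      unfolding set_borel_measurable_def by measurable
    show "AE x in lborel. x \<in> {0<..<d} \<longrightarrow> norm (1 / (x * (ln 1 - ln x))) \<le> norm (of_real (1 / E) * h x)"
    proof (intro AE_I2 impI)
      fix x assume x: "x \<in> {0<..<d}"
      then have "1 / (x * (ln 1 - ln x)) \<ge> 0" using d by (auto intro!: mult_nonneg_nonpos)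
      then have "norm (1 / (x * (ln 1 - ln x))) = 1 / (x * (ln 1 - ln x))"
        unfolding real_norm_def by (rule abs_of_nonneg)
      then show "norm (1 / (x * (ln 1 - ln x))) \<le> norm (of_real (1 / E) * h x)"
        using bound[of x] x by simp
    qed
  qed
  then obtain B where B: "\<And>x. 0 < x \<Longrightarrow> x < d \<Longrightarrow> \<bar>ln (ln 1 - ln x)\<bar> \<le> B"
    using log_log_bounded_if_integrable[of 0 d 1] d by auto
  have "filterlim (\<lambda>x::real. ln (ln 1 - ln x)) at_top (at_right 0)" by real_asymp
  then have "\<forall>\<^sub>F x::real in at_right 0. ln (ln 1 - ln x) \<ge> B + 1" by (simp add: filterlim_at_top)
  moreover have "\<forall>\<^sub>F x in at_right 0. x \<in> {0<..<d}" using d by (intro eventually_at_right_real) auto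
  ultimately have "\<forall>\<^sub>F x::real in at_right 0. False"
    by eventually_elim (use B in fastforce)
  then show False by simp
qed

text \<open>
The logarithm vanishes at \<open>p = 1 / \<alpha>\<close>, which is in \<open>(0, 1]\<close>. For \<open>Re k \<le> -1\<close> the absolute value of
the integrand would be at least a multiple of \<open>1 / (x log (p / x))\<close> to the left of \<open>p\<close>, the derivative
of the unbounded function \<open>- log (log (p / x))\<close>.
\<close>
lemma exponent_condition_at_log_zero:
  fixes k m :: complex and \<alpha> :: real
  assumes \<alpha>: "\<alpha> \<ge> 1"
      and int: "set_integrable lborel {0<..<1}
                  (\<lambda>x. of_real x powr (- 1 + m) * Ln (of_real \<alpha> * of_real x) powr k)"
  shows "Re k > - 1"
proof (rule ccontr)
  assume "\<not> ?thesis"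
  then have k: "Re k \<le> - 1" by simp
  define h where "h = (\<lambda>x::real. of_real x powr (- 1 + m) * Ln (of_real \<alpha> * of_real x) powr k)"
  define p where "p = 1 / \<alpha>"
  have p: "0 < p" "p \<le> 1" using \<alpha> by (auto simp: p_def)
  define E where "E = exp (- (pi * \<bar>Im k\<bar>))"
  \<comment> \<open>On \<open>(l, p)\<close> one has \<open>0 < log (p / x) < 1\<close>, so the power \<open>Re k \<le> -1\<close> of this is at least the
    power \<open>-1\<close>.\<close>
  define l where "l = p * exp (- 1)"
  have l: "0 < l" "l < p" using p by (auto simp: l_def)
  define C where "C = (l powr (- Re m) + p powr (- Re m)) / E"
  have lnp: "ln p = - ln \<alpha>" using \<alpha> by (simp add: p_def ln_div)
  have pos: "ln p - ln x > 0" "ln p - ln x < 1" if "l < x" "x < p" for x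
  proof -
    have "x > 0" using that l by linarith
    then have "ln l < ln x" "ln x < ln p" using that l by auto
    moreover have "ln l = ln p - 1" using p by (simp add: l_def ln_mult)
    ultimately show "ln p - ln x > 0" "ln p - ln x < 1" by auto
  qed
  have bound: "1 / (x * (ln p - ln x)) \<le> norm (of_real C * h x)" if x: "l < x" "x < p" for x
  proof -
    define y where "y = ln p - ln x"
    have y: "0 < y" "y < 1" using pos[OF x] by (auto simp: y_def)
    have x0: "x > 0" using x l by linarith
    have "Ln (of_real \<alpha> * of_real x) = of_real (ln (\<alpha> * x))"
      using \<alpha> x0 by (subst Ln_of_real[symmetric]) auto
    also have "ln (\<alpha> * x) = - y" using \<alpha> x0 by (simp add: y_def lnp ln_mult)
    finally have L: "norm (Ln (of_real \<alpha> * of_real x)) = y" using y by simp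
    have "y powr (- 1) \<le> y powr Re k" using y k by (intro powr_mono') auto
    then have "1 / y * E \<le> y powr Re k * E" using y by (intro mult_right_mono) (auto simp: powr_minus field_simps E_def)
    also have "\<dots> \<le> norm (Ln (of_real \<alpha> * of_real x) powr k)"
      using norm_powr_ge[of "Ln (of_real \<alpha> * of_real x)" k] by (simp add: L E_def)
    finally have 1: "1 / y \<le> norm (Ln (of_real \<alpha> * of_real x) powr k) / E"
      by (simp add: E_def field_simps)
    have 2: "x powr (- Re m) \<le> l powr (- Re m) + p powr (- Re m)"
      using x l by (intro powr_between_le) auto
    have "x powr (- Re m) * x powr (Re m - 1) = x powr (- 1)" by (simp add: powr_add[symmetric])
    also have "\<dots> = 1 / x" using x0 by (simp add: powr_minus_divide)
    finally have "1 / (x * y) = (x powr (- Re m) * x powr (Re m - 1)) * (1 / y)" by simp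
    also have "\<dots> \<le> ((l powr (- Re m) + p powr (- Re m)) * x powr (Re m - 1))
               * (norm (Ln (of_real \<alpha> * of_real x) powr k) / E)"
      using 1 2 y by (intro mult_mono) auto
    also have "\<dots> = C * norm (h x)"
      using x0 by (simp add: C_def h_def norm_mult norm_powr_real_powr field_simps)
    also have "\<dots> = norm (of_real C * h x)"
    proof -
      have "C \<ge> 0" by (simp add: C_def E_def)
      then show ?thesis by (simp add: norm_mult)
    qed
    finally show ?thesis by (simp add: y_def)
  qed
  have "set_integrable lborel {l<..<p} (\<lambda>x. of_real C * h x)"
    by (intro set_integrable_mult_right set_integrable_subset[OF int[folded h_def]]) (use p l in auto)
  then have "set_integrable lborel {l<..<p} (\<lambda>x. 1 / (x * (ln p - ln x)))"
  proof (rule set_integrable_bound)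
    show "set_borel_measurable lborel {l<..<p} (\<lambda>x. 1 / (x * (ln p - ln x)))"
      unfolding set_borel_measurable_def by measurable
    show "AE x in lborel. x \<in> {l<..<p} \<longrightarrow> norm (1 / (x * (ln p - ln x))) \<le> norm (of_real C * h x)"
    proof (intro AE_I2 impI)
      fix x assume x: "x \<in> {l<..<p}"
      then have "1 / (x * (ln p - ln x)) \<ge> 0" using pos[of x] l by auto
      then have "norm (1 / (x * (ln p - ln x))) = 1 / (x * (ln p - ln x))"
        unfolding real_norm_def by (rule abs_of_nonneg)
      then show "norm (1 / (x * (ln p - ln x))) \<le> norm (of_real C * h x)"
        using bound[of x] x by simp
    qed
  qed
  then obtain B where B: "\<And>x. l < x \<Longrightarrow> x < p \<Longrightarrow> \<bar>ln (ln p - ln x)\<bar> \<le> B"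
    using log_log_bounded_if_integrable[of l p p] l by auto
  have "B \<ge> 0" using B[of "(l + p) / 2"] l by (auto intro: order_trans[OF abs_ge_zero])
  \<comment> \<open>The point at which \<open>log (log (p / x)) = - (B + 1)\<close>.\<close>
  define x where "x = p * exp (- exp (- (B + 1)))"
  have "l < x" "x < p" using p \<open>B \<ge> 0\<close> by (auto simp: l_def x_def)
  moreover have "ln p - ln x = exp (- (B + 1))" using p by (simp add: x_def ln_mult)
  ultimately have "\<bar>- (B + 1)\<bar> \<le> B" using B[of x] by simp
  then show False by linarith
qed

section \<open>The integrals of powers times powers of a logarithm\<close>

lemma set_integral_eq_diff_limits:
  fixes f F :: "real \<Rightarrow> 'a :: euclidean_space"
  assumes ab: "a < b" and int: "set_integrable lborel {a<..<b} f" and N: "finite N"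
      and deriv: "\<And>x. a < x \<Longrightarrow> x < b \<Longrightarrow> x \<notin> N \<Longrightarrow> (F has_vector_derivative f x) (at x)"
      and cont: "\<And>x. a < x \<Longrightarrow> x < b \<Longrightarrow> isCont F x"
      and A: "(F \<longlongrightarrow> A) (at_right a)" and B: "(F \<longlongrightarrow> B) (at_left b)"
  shows "(LBINT x:{a<..<b}. f x) = B - A"
proof -
  define G where "G = (\<lambda>x. if x \<le> a then A else if x \<ge> b then B else F x)"
  have FG: "\<forall>\<^sub>F y in nhds x. F y = G y" if "a < x" "x < b" for x
    using eventually_nhds_in_open[of "{a<..<b}" x] that by (auto simp: G_def elim!: eventually_mono)
  have "(f has_integral (G b - G a)) {a..b}"
  proof (rule fundamental_theorem_of_calculus_interior_strong[OF N])
    show "(G has_vector_derivative f x) (at x)" if "x \<in> {a<..<b} - N" for x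
    proof (rule has_vector_derivative_transform_within_open[OF deriv, of x "{a<..<b}"])
      show "\<And>y. y \<in> {a<..<b} \<Longrightarrow> F y = G y" by (auto simp: G_def)
    qed (use that in auto)
    show "continuous_on {a..b} G"
    proof (rule continuous_on_IccI)
      have "\<forall>\<^sub>F x in at_right a. F x = G x"
        using eventually_at_right_real[OF ab] by eventually_elim (auto simp: G_def)
      from Lim_transform_eventually[OF A this] show "(G \<longlongrightarrow> G a) (at_right a)"
        using ab by (simp add: G_def)
      have "\<forall>\<^sub>F x in at_left b. F x = G x"
        using eventually_at_left_real[OF ab] by eventually_elim (auto simp: G_def)
      from Lim_transform_eventually[OF B this] show "(G \<longlongrightarrow> G b) (at_left b)"
        using ab by (simp add: G_def)
      fix x assume x: "a < x" "x < b"
      have "isCont G x" using cont[OF x] isCont_cong[OF FG[OF x]] by simp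
      then show "G \<midarrow>x\<rightarrow> G x" by (simp add: isCont_def)
    qed (rule ab)
  qed (use ab in simp)
  then have "(f has_integral (B - A)) {a<..<b}"
    using ab by (simp add: has_integral_Icc_iff_Ioo G_def)
  then show ?thesis
    using set_borel_integral_eq_integral(2)[OF int] by (simp add: integral_unique)
qed

text \<open>
The claimed derivative is entire, so it has an entire primitive \<open>P\<close>. The incomplete gamma integral
differs from \<open>P\<close> by a constant on the slit plane and, by taking limits from above, by the same
constant on the cut.
\<close>
lemma has_field_derivative_upper_Gamma_integral_nat:
  "(upper_Gamma_integral (1 + of_nat j) has_field_derivative - (u ^ j * exp (- u))) (at u)"
proof -
  define H where "H = upper_Gamma_integral (1 + of_nat j)"
  have holo: "(\<lambda>u::complex. - (u ^ j * exp (- u))) holomorphic_on UNIV" by (intro holomorphic_intros)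
  obtain P where P_within: "\<And>u::complex. u \<in> UNIV \<Longrightarrow>
      (P has_field_derivative - (u ^ j * exp (- u))) (at u within UNIV)"
    by (rule holomorphic_convex_primitive'[OF convex_UNIV open_UNIV holo]) blast
  have P: "(P has_field_derivative - (u ^ j * exp (- u))) (at u)" for u
    using P_within[of u] by simp
  have conn: "connected (- \<real>\<^sub>\<le>\<^sub>0 :: complex set)"
    by (rule starlike_imp_connected[OF starlike_slit_plane])
  have d: "((\<lambda>u. H u - P u) has_field_derivative 0) (at u)" if "u \<in> - \<real>\<^sub>\<le>\<^sub>0" for u
    unfolding H_def using that
    by (auto intro!: derivative_eq_intros has_field_derivative_upper_Gamma_integral P simp: powr_nat)
  have "(\<lambda>u. H u - P u) constant_on (- \<real>\<^sub>\<le>\<^sub>0)"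
    by (rule DERIV_zero_connected_constant_on[OF conn _ finite.emptyI])
       (use d in \<open>auto intro!: continuous_at_imp_continuous_on DERIV_isCont\<close>)
  then obtain c where c: "\<And>u. u \<in> - \<real>\<^sub>\<le>\<^sub>0 \<Longrightarrow> H u - P u = c"
    unfolding constant_on_def by blast
  have "H z = P z + c" for z
  proof (cases "z \<in> \<real>\<^sub>\<le>\<^sub>0")
    case True
    then have z: "Im z = 0" "Re z \<le> 0" by (auto simp: complex_nonpos_Reals_iff)
    obtain X where X: "X \<longlonglongrightarrow> z" "\<And>n. Im (X n) > 0" "(\<lambda>n. H (X n)) \<longlonglongrightarrow> H z"
      unfolding H_def
      by (rule upper_Gamma_integral_limit_along_sequence_above[OF _ z, of "1 + of_nat j"]) auto
    note X(3)
    moreover have "H (X n) = P (X n) + c" for n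
      using c[of "X n"] X(2)[of n] by (auto simp: complex_nonpos_Reals_iff algebra_simps)
    moreover have "(\<lambda>n. P (X n) + c) \<longlonglongrightarrow> P z + c"
      by (intro tendsto_intros isCont_tendsto_compose[OF DERIV_isCont[OF P]] X(1))
    ultimately show ?thesis using LIMSEQ_unique by simp
  qed (use c in \<open>auto simp: algebra_simps\<close>)
  then have "H = (\<lambda>z. P z + c)" by blast
  then show ?thesis
    unfolding H_def[symmetric] by (auto intro!: derivative_eq_intros P)
qed

text \<open>
The fundamental theorem of calculus for the primitive \<open>a ^ (-m) (-1) ^ k m ^ (-1 - k) \<Gamma>(1 + k, u(x))\<close>.
At the point \<open>x = 1 / a\<close>, if it lies in the interval, \<open>log (a x)\<close> vanishes; there only continuity is
required.
\<close>
lemma integral_powr_Ln_powr_if_branches: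
  fixes a m k G :: complex
  defines "u \<equiv> \<lambda>x::real. - (m * Ln (a * of_real x))"
  assumes a: "a \<noteq> 0" and m: "m \<noteq> 0" "Re m > 0 \<or> (Re m = 0 \<and> Re k < - 1)"
      and int: "set_integrable lborel {0<..<1}
                  (\<lambda>x. of_real x powr (- 1 + m) * Ln (a * of_real x) powr k)"
      and deriv: "\<And>x. 0 < x \<Longrightarrow> x < 1 \<Longrightarrow> a * of_real x \<noteq> 1 \<Longrightarrow>
            (upper_Gamma_integral (1 + k) has_field_derivative - (u x powr k * exp (- u x))) (at (u x))"
      and branch: "\<And>x. 0 < x \<Longrightarrow> x < 1 \<Longrightarrow> a * of_real x \<noteq> 1 \<Longrightarrow>
            Ln (a * of_real x) powr k = (- 1) powr k * m powr (- k) * u x powr k"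
      and cont: "\<And>x. 0 < x \<Longrightarrow> x < 1 \<Longrightarrow> a * of_real x = 1 \<Longrightarrow>
            isCont (\<lambda>x. upper_Gamma_integral (1 + k) (u x)) x"
      and lim: "((\<lambda>x. upper_Gamma_integral (1 + k) (u x)) \<longlongrightarrow> G) (at_left 1)"
  shows "(LBINT x:{0<..<1}. of_real x powr (- 1 + m) * Ln (a * of_real x) powr k)
           = a powr (- m) * (- 1) powr k * m powr (- 1 - k) * G"
proof -
  define c where "c = a powr (- m) * (- 1) powr k * m powr (- 1 - k)"
  define F where "F = (\<lambda>x. c * upper_Gamma_integral (1 + k) (u x))"
  define f where "f = (\<lambda>x::real. of_real x powr (- 1 + m) * Ln (a * of_real x) powr k)"
  have u: "u x = - (m * (Ln a + of_real (ln x)))" if "x > 0" for x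
    using Ln_times_real[OF a that] by (simp add: u_def)
  have F': "(F has_vector_derivative f x) (at x)" if x: "0 < x" "x < 1" "a * of_real x \<noteq> 1" for x
  proof -
    have "((\<lambda>w. - (m * (Ln a + Ln w))) has_field_derivative - (m / of_real x)) (at (of_real x))"
      using x by (auto intro!: derivative_eq_intros simp: complex_nonpos_Reals_iff field_simps)
    from has_vector_derivative_real_field[OF this]
    have "((\<lambda>y. - (m * (Ln a + Ln (of_real y)))) has_vector_derivative - (m / of_real x)) (at x)" .
    then have "(u has_vector_derivative - (m / of_real x)) (at x)"
    proof (rule has_vector_derivative_transform_within_open[of _ _ _ "{0<..}"])
      show "- (m * (Ln a + Ln (of_real y))) = u y" if "y \<in> {0<..}" for y
        using that by (simp add: u Ln_of_real)
    qed (use x in auto)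
    from field_vector_diff_chain_at[OF this deriv[OF x]]
    have "((\<lambda>x. upper_Gamma_integral (1 + k) (u x)) has_vector_derivative
           - (m / of_real x) * - (u x powr k * exp (- u x))) (at x)" by (simp add: o_def)
    then have "(F has_vector_derivative c * (- (m / of_real x) * - (u x powr k * exp (- u x)))) (at x)"
      unfolding F_def by (rule has_vector_derivative_mult_right)
    also have "c * (- (m / of_real x) * - (u x powr k * exp (- u x))) = f x"
    proof -
      have "exp (- u x) = exp (m * Ln a) * exp (m * of_real (ln x))"
        using x by (simp add: u exp_add[symmetric] algebra_simps)
      also have "exp (m * of_real (ln x)) = of_real x * of_real x powr (- 1 + m)"
        using x by (simp add: powr_def Ln_of_real exp_add[symmetric] algebra_simps exp_diff exp_of_real)
      finally have 1: "exp (- u x) = exp (m * Ln a) * (of_real x * of_real x powr (- 1 + m))" .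
      have 2: "a powr (- m) * exp (m * Ln a) = 1"
        using a by (simp add: powr_def exp_minus)
      have 3: "m powr (- 1 - k) * m = m powr (- k)"
        using m by (simp add: powr_diff powr_minus field_simps)
      have "c * (- (m / of_real x) * - (u x powr k * exp (- u x)))
          = (a powr (- m) * exp (m * Ln a)) * ((- 1) powr k * (m powr (- 1 - k) * m) * u x powr k)
             * of_real x powr (- 1 + m)"
        unfolding 1 c_def using x by (simp add: field_simps)
      also have "\<dots> = f x"
        unfolding 2 3 f_def branch[OF x] by (simp add: mult_ac)
      finally show ?thesis .
    qed
    finally show ?thesis .
  qed
  have "(LBINT x:{0<..<1}. f x) = c * G - c * 0"
  proof (rule set_integral_eq_diff_limits[where N = "{Re (1 / a)}" and F = F])
    fix x :: real assume x: "0 < x" "x < 1"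
    show "(F has_vector_derivative f x) (at x)" if "x \<notin> {Re (1 / a)}"
    proof (rule F'[OF x])
      show "a * of_real x \<noteq> 1"
      proof
        assume "a * of_real x = 1"
        then have "1 / a = of_real x" using a by (simp add: field_simps)
        then show False using that by simp
      qed
    qed
    show "isCont F x"
    proof (cases "a * of_real x = 1")
      case True
      then show ?thesis unfolding F_def by (intro continuous_intros cont x)
    next
      case False
      then show ?thesis using F'[OF x] has_vector_derivative_continuous by blast
    qed
  next
    have "((\<lambda>y. upper_Gamma_integral (1 + k) (- (m * Ln a) + m * of_real y)) \<longlongrightarrow> 0) at_top"
      by (rule upper_Gamma_integral_tendsto_0) (use m in auto)
    moreover have "filterlim (\<lambda>x::real. - ln x) at_top (at_right 0)" by real_asymp
    ultimately have "((\<lambda>x. upper_Gamma_integral (1 + k) (- (m * Ln a) + m * of_real (- ln x))) \<longlongrightarrow> 0) (at_right 0)"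
      by (rule filterlim_compose)
    then have "((\<lambda>x. upper_Gamma_integral (1 + k) (u x)) \<longlongrightarrow> 0) (at_right 0)"
    proof (rule Lim_transform_eventually)
      show "\<forall>\<^sub>F x in at_right 0. upper_Gamma_integral (1 + k) (- (m * Ln a) + m * of_real (- ln x))
              = upper_Gamma_integral (1 + k) (u x)"
        using eventually_at_right_less[of "0::real"]
        by eventually_elim (simp add: u algebra_simps)
    qed
    then show "(F \<longlongrightarrow> c * 0) (at_right 0)" unfolding F_def by (intro tendsto_intros)
    show "(F \<longlongrightarrow> c * G) (at_left 1)" unfolding F_def by (intro tendsto_intros lim)
    show "set_integrable lborel {0<..<1} f" unfolding f_def by (rule int)
  qed auto
  then show ?thesis by (simp add: f_def c_def)
qed

lemma powr_int_mult_neg: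
  fixes m L k :: complex
  assumes "k \<in> \<int>" "m \<noteq> 0" "L \<noteq> 0"
  shows "L powr k = (- 1) powr k * m powr (- k) * (- (m * L)) powr k"
proof -
  obtain i where k: "k = of_int i" using assms(1) by (auto elim: Ints_cases)
  define s M where "s = (- 1 :: complex) powi i" and "M = m powi i"
  have ss: "s * s = 1"
    using power_int_mult_distrib[of "-1" "-1::complex" i] by (simp add: s_def)
  have M: "M \<noteq> 0" using assms(2) by (simp add: M_def)
  have "(- (m * L)) powr k = (- 1 * m * L) powi i"
    using assms by (simp add: k complex_powr_of_int)
  also have "\<dots> = s * M * L powi i"
    by (simp only: s_def M_def power_int_mult_distrib)
  finally have 1: "(- (m * L)) powr k = s * M * L powi i" .
  have 2: "(- 1) powr k = s" "m powr (- k) = inverse M" "L powr k = L powi i"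
    using assms by (simp_all add: powr_minus k complex_powr_of_int s_def M_def)
  have "s * inverse M * (s * M * L powi i) = (s * s) * (inverse M * M) * L powi i"
    by (simp only: mult_ac)
  also have "\<dots> = L powi i" using M by (simp add: ss)
  finally show ?thesis by (simp only: 1 2)
qed

lemma nonpos_Reals_nonzeroD:
  fixes q :: complex
  assumes "q \<in> \<real>\<^sub>\<le>\<^sub>0" "q \<noteq> 0"
  shows "Re q < 0" "Im q = 0"
  using assms by (auto simp: complex_nonpos_Reals_iff complex_eq_iff less_le)

text \<open>
Here \<open>0 < Arg m + Arg L < 2 \<pi>\<close>, so \<open>log m + log L - i \<pi>\<close> has its imaginary part strictly between
\<open>-\<pi>\<close> and \<open>\<pi>\<close> and is the principal logarithm of \<open>-m L\<close>.
\<close>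
lemma powr_mult_neg_of_Arg_sum_pos:
  fixes m L k :: complex
  assumes nz: "m \<noteq> 0" "L \<noteq> 0" and m: "Re m \<ge> 0" and sum: "0 < Arg m + Arg L"
  shows "- (m * L) \<notin> \<real>\<^sub>\<le>\<^sub>0"
    and "L powr k = (- 1) powr k * m powr (- k) * (- (m * L)) powr k"
proof -
  have "\<bar>Arg m\<bar> \<le> pi / 2" using m Arg_Re_nonneg[of m] by blast
  then have up: "Arg m + Arg L < 2 * pi" using Arg_le_pi[of L] by (smt (verit) pi_gt_zero field_sum_of_halves)
  have Ln: "Ln (- (m * L)) = Ln m + Ln L - \<i> * of_real pi"
  proof (rule Ln_unique)
    show "exp (Ln m + Ln L - \<i> * of_real pi) = - (m * L)"
      using nz by (simp add: exp_add exp_diff)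
  qed (use sum up nz in \<open>auto simp: Arg_eq_Im_Ln[symmetric]\<close>)
  show "- (m * L) \<notin> \<real>\<^sub>\<le>\<^sub>0"
  proof
    assume "- (m * L) \<in> \<real>\<^sub>\<le>\<^sub>0"
    then have "Im (Ln (- (m * L))) = pi"
      using nz nonpos_Reals_nonzeroD[of "- (m * L)"] by (subst Im_Ln_eq_pi) simp_all
    then show False using up nz by (simp add: Ln Arg_eq_Im_Ln)
  qed
  have "(- 1) powr k * m powr (- k) * (- (m * L)) powr k
      = exp (k * (\<i> * of_real pi) + (- k) * Ln m + k * Ln (- (m * L)))"
    using nz by (simp add: powr_def exp_add[symmetric])
  also have "k * (\<i> * of_real pi) + (- k) * Ln m + k * Ln (- (m * L)) = k * Ln L"
    unfolding Ln by (simp add: algebra_simps)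
  finally show "L powr k = (- 1) powr k * m powr (- k) * (- (m * L)) powr k"
    using nz by (simp add: powr_def)
qed

lemma log_ray_tendsto:
  fixes a m :: complex
  assumes "a \<noteq> 0" "x > 0"
  shows "((\<lambda>x. - (m * Ln (a * of_real x))) \<longlongrightarrow> - (m * Ln (a * of_real x))) (at x within S)"
proof -
  have "isCont (\<lambda>y. - (m * (Ln a + of_real (ln y)))) x"
    using assms(2) by (intro continuous_intros) auto
  then have "((\<lambda>y. - (m * (Ln a + of_real (ln y)))) \<longlongrightarrow> - (m * (Ln a + of_real (ln x)))) (at x within S)"
    unfolding isCont_def by (rule tendsto_within_subset) auto
  moreover have "\<forall>\<^sub>F y in at x within S. y > 0"
    using order_tendstoD(1)[OF tendsto_ident_at assms(2)] .
  then have "\<forall>\<^sub>F y in at x within S. - (m * (Ln a + of_real (ln y))) = - (m * Ln (a * of_real y))"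
    by eventually_elim (simp add: Ln_times_real[OF assms(1)])
  ultimately show ?thesis
    using Ln_times_real[OF assms] by (simp add: Lim_transform_eventually)
qed

text \<open>
The three alternatives of \<open>consistent_branches\<close> differ in how \<open>u(x) = -m log (a x)\<close> lies relative to
the cut. For natural \<open>k\<close> the cut does not matter. In the second case \<open>u(x)\<close> meets it at most in \<open>0\<close>,
which happens for real \<open>a \<ge> 1\<close> only. In the third case \<open>u(x)\<close> avoids it for \<open>x < 1\<close>, and the endpoint
may be a negative number that is approached from above.
\<close>
lemma integral_powr_Ln_powr:
  fixes a m k :: complex
  assumes a: "a \<noteq> 0" and m: "m \<noteq> 0" and br: "consistent_branches k a m"
      and int: "set_integrable lborel {0<..<1}
                  (\<lambda>x. of_real x powr (- 1 + m) * Ln (a * of_real x) powr k)"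
  shows "(LBINT x:{0<..<1}. of_real x powr (- 1 + m) * Ln (a * of_real x) powr k)
           = a powr (- m) * (- 1) powr k * m powr (- 1 - k) * upper_Gamma (1 + k) (- (m * Ln a))"
proof -
  have mk: "Re m > 0 \<or> (Re m = 0 \<and> Re k < - 1)"
    by (rule exponent_conditions_at_0[OF a int])
  then have m0: "Re m \<ge> 0" by auto
  define H where "H = upper_Gamma_integral (1 + k)"
  define u where "u = (\<lambda>x::real. - (m * Ln (a * of_real x)))"
  have u_lim: "(u \<longlongrightarrow> u x) (at x within S)" if "x > 0" for x S
    unfolding u_def by (rule log_ray_tendsto[OF a that])
  have L: "Ln (a * of_real x) = Ln a + of_real (ln x)" if "x > 0" for x
    by (rule Ln_times_real[OF a that])
  have L0: "Ln (a * of_real x) \<noteq> 0" if "x > 0" "a * of_real x \<noteq> 1" for x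
    using that a by (metis Ln_1 Ln_eq_iff mult_eq_0_iff of_real_eq_0_iff less_irrefl one_neq_zero)
  have deriv: "(H has_field_derivative - (u x powr k * exp (- u x))) (at (u x))"
    if "u x \<notin> \<real>\<^sub>\<le>\<^sub>0" for x
    using has_field_derivative_upper_Gamma_integral[OF that, of "1 + k"] by (simp add: H_def)
  have lim_off_cut: "((\<lambda>x. H (u x)) \<longlongrightarrow> upper_Gamma (1 + k) (- (m * Ln a))) (at_left 1)"
    if "- (m * Ln a) \<notin> \<real>\<^sub>\<le>\<^sub>0"
  proof -
    have u1: "u 1 = - (m * Ln a)" by (simp add: u_def)
    have "((\<lambda>x. H (u x)) \<longlongrightarrow> H (u 1)) (at_left 1)"
      using deriv[of 1] that
      by (intro isCont_tendsto_compose[OF DERIV_isCont u_lim]) (auto simp: u1)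
    then show ?thesis using upper_Gamma_eq_integral_off_cut[OF that] by (simp add: H_def u1)
  qed
  consider "k \<in> \<nat>" | "0 \<le> Arg a" "a = 1 \<or> 0 < Arg m + Arg (Ln a)"
    | "k \<in> \<int>" "Arg a < 0" "Arg m + Arg (Ln a) \<le> 0"
    using br unfolding consistent_branches_def by blast
  then show ?thesis
  proof cases
    case 1
    then obtain j where k: "k = of_nat j" by (auto elim: Nats_cases)
    have H': "(H has_field_derivative - (q ^ j * exp (- q))) (at q)" for q
      unfolding H_def k by (rule has_field_derivative_upper_Gamma_integral_nat)
    have H_lim: "((\<lambda>x. H (u x)) \<longlongrightarrow> H (u x)) (at x within S)" if "x > 0" for x S
      by (rule isCont_tendsto_compose[OF DERIV_isCont[OF H'] u_lim[OF that]])
    show ?thesis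
    proof (rule integral_powr_Ln_powr_if_branches[OF a m mk int])
      fix x :: real assume x: "0 < x" "x < 1" "a * of_real x \<noteq> 1"
      have u0: "u x \<noteq> 0" using L0[OF x(1,3)] m by (simp add: u_def)
      show "(upper_Gamma_integral (1 + k) has_field_derivative
         - ((- (m * Ln (a * of_real x))) powr k * exp (- (- (m * Ln (a * of_real x))))))
          (at (- (m * Ln (a * of_real x))))"
        using H'[of "u x"] u0 unfolding H_def u_def k by (simp add: powr_nat')
      show "Ln (a * of_real x) powr k = (- 1) powr k * m powr (- k) * (- (m * Ln (a * of_real x))) powr k"
        by (rule powr_int_mult_neg[OF _ m L0[OF x(1,3)]]) (simp add: k)
    next
      show "isCont (\<lambda>x. upper_Gamma_integral (1 + k) (- (m * Ln (a * of_real x)))) x"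
        if "0 < x" for x :: real
        using H_lim[OF that] unfolding isCont_def H_def u_def .
      have "upper_Gamma (1 + k) (- (m * Ln a)) = H (u 1)"
        using upper_Gamma_eq_integral[of "1 + k"] by (simp add: H_def u_def k)
      then show "((\<lambda>x. upper_Gamma_integral (1 + k) (- (m * Ln (a * of_real x))))
            \<longlongrightarrow> upper_Gamma (1 + k) (- (m * Ln a))) (at_left 1)"
        using H_lim[of 1 "{..<1}"] by (simp add: H_def u_def)
    qed
  next
    case 2
    \<comment> \<open>On the way from \<open>x = 1\<close> to \<open>x = 0\<close> the point \<open>log (a x)\<close> moves horizontally to the left: above the
      real axis this increases its argument, and on the real axis the argument changes from \<open>0\<close> to \<open>\<pi>\<close>.\<close>
    have sum: "0 < Arg m + Arg (Ln (a * of_real x))" if x: "0 < x" "x < 1" "a * of_real x \<noteq> 1" for x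
    proof (cases "Arg a = 0")
      case True
      then obtain \<alpha> where \<alpha>: "a = of_real \<alpha>" "\<alpha> > 0"
        using a by (auto simp: Arg_eq_0 elim!: Reals_cases)
      then have Lx: "Ln (a * of_real x) = of_real (ln (\<alpha> * x))"
        using x by (simp flip: of_real_mult Ln_of_real)
      have "\<alpha> * x \<noteq> 1" using x \<alpha> by (metis of_real_1 of_real_mult)
      have \<alpha>x: "\<alpha> * x > 0" using \<alpha> x by simp
      show ?thesis
      proof (cases "\<alpha> * x < 1")
        case True
        then have "Arg (Ln (a * of_real x)) = pi"
          unfolding Lx Arg_of_real using \<alpha>x by simp
        moreover have "- (pi / 2) \<le> Arg m" using m0 Arg_Re_nonneg[of m] by linarith
        ultimately show ?thesis using pi_gt_zero by linarith
      next
        case False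
        then have gt: "\<alpha> * x > 1" using \<open>\<alpha> * x \<noteq> 1\<close> by simp
        moreover have "\<alpha> * x < \<alpha>" using \<alpha> x by simp
        ultimately have "\<alpha> > 1" by linarith
        then have "a \<noteq> 1" "Arg (Ln a) = 0" using \<alpha> by (auto simp: Ln_of_real Arg_of_real)
        then have "0 < Arg m" using 2 by simp
        moreover have "Arg (Ln (a * of_real x)) = 0"
          unfolding Lx Arg_of_real using gt by simp
        ultimately show ?thesis by simp
      qed
    next
      case False
      then have Arga: "Arg a > 0" using 2 by simp
      then have "a \<noteq> 1" by auto
      then have "0 < Arg m + Arg (Ln a)" using 2 by simp
      moreover have "Im (Ln (a * of_real x)) > 0"
        using Arga a x by (simp add: L Arg_eq_Im_Ln)
      then have "Arg (Ln (a * of_real x) + of_real (- ln x)) < Arg (Ln (a * of_real x))"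
        using x by (intro Arg_add_of_real_less) auto
      then have "Arg (Ln a) < Arg (Ln (a * of_real x))" using x by (simp add: L)
      ultimately show ?thesis by linarith
    qed
    have real_a: "Re k > - 1" if "a = of_real \<alpha>" "\<alpha> \<ge> 1" for \<alpha>
      using exponent_condition_at_log_zero[OF that(2)] int unfolding that(1) by blast
    show ?thesis
    proof (rule integral_powr_Ln_powr_if_branches[OF a m mk int])
      fix x :: real assume x: "0 < x" "x < 1" "a * of_real x \<noteq> 1"
      note * = powr_mult_neg_of_Arg_sum_pos[OF m L0[OF x(1,3)] m0 sum[OF x]]
      show "(upper_Gamma_integral (1 + k) has_field_derivative
         - ((- (m * Ln (a * of_real x))) powr k * exp (- (- (m * Ln (a * of_real x))))))
          (at (- (m * Ln (a * of_real x))))"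
        using deriv[of x] *(1) unfolding H_def u_def by blast
      show "Ln (a * of_real x) powr k = (- 1) powr k * m powr (- k) * (- (m * Ln (a * of_real x))) powr k"
        by (rule *(2))
    next
      fix x :: real assume x: "0 < x" "x < 1" "a * of_real x = 1"
      have a_eq: "a = of_real (1 / x)" using x by (simp add: field_simps)
      have x1: "1 / x > 1" using x by simp
      have k1: "Re (1 + k) > 0" using real_a[OF a_eq] x1 by simp
      have "Arg (Ln a) = 0" "a \<noteq> 1"
        using x1 x by (auto simp: a_eq Ln_of_real Arg_of_real simp del: of_real_divide)
      then have "Arg m > 0" using 2 by simp
      then have Im: "Im m > 0" using m0 by (auto simp: Arg_pos_iff)
      \<comment> \<open>Near \<open>x = 1 / a\<close> the points \<open>u(x)\<close> lie on the line through \<open>0\<close> and \<open>m\<close>, which has distance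
        \<open>v Im m / |m|\<close> from \<open>-v\<close>.\<close>
      define c where "c = Im m / norm m"
      have c: "c > 0" using Im m by (simp add: c_def)
      have "((\<lambda>x. H (u x)) \<longlongrightarrow> H (u x)) (at x within {0<..})"
        unfolding tendsto_at_iff_sequentially comp_def
      proof (intro allI impI)
        fix X assume X: "\<forall>i. X i \<in> {0<..} - {x}" "X \<longlonglongrightarrow> x"
        have ux: "u x = 0" using x by (simp add: u_def)
        have uX: "u (X n) = - (m * of_real (ln (X n / x)))" for n
        proof -
          have "X n > 0" using X by auto
          then have "Ln (a * of_real (X n)) = Ln (of_real (X n / x))" by (simp add: a_eq)
          also have "\<dots> = of_real (ln (X n / x))" using \<open>X n > 0\<close> x by (intro Ln_of_real) simp
          finally show ?thesis by (simp add: u_def)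
        qed
        show "(\<lambda>n. H (u (X n))) \<longlonglongrightarrow> H (u x)"
          unfolding H_def
        proof (rule upper_Gamma_integral_tendsto_boundary[OF k1 _ _ _ c])
          show "(\<lambda>n. u (X n)) \<longlonglongrightarrow> u x"
            using u_lim[OF x(1), of "{0<..}"] X unfolding tendsto_at_iff_sequentially comp_def by blast
          fix n :: nat and v :: real assume v: "v > 0"
          have "v * Im m = \<bar>Im ((u (X n) + of_real v) * cnj m)\<bar>"
            using v Im by (simp add: uX algebra_simps)
          also have "\<dots> \<le> norm (u (X n) + of_real v) * norm m"
            using abs_Im_le_cmod[of "(u (X n) + of_real v) * cnj m"] by (simp add: norm_mult)
          finally show "c * norm (u x + of_real v) \<le> norm (u (X n) + of_real v)"
            using v m by (simp add: c_def ux field_simps)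
        qed (simp_all add: ux)
      qed
      then have "isCont (\<lambda>x. H (u x)) x"
        unfolding isCont_def using x by (simp add: at_within_open[of x "{0<..}"])
      then show "isCont (\<lambda>x. upper_Gamma_integral (1 + k) (- (m * Ln (a * of_real x)))) x"
        by (simp add: H_def u_def)
    next
      have "((\<lambda>x. H (u x)) \<longlongrightarrow> upper_Gamma (1 + k) (- (m * Ln a))) (at_left 1)"
      proof (cases "a = 1")
        case True
        have k1: "Re (1 + k) > 0" using real_a[of 1] True by simp
        then have "Re m > 0" using mk by simp
        have "((\<lambda>x. H (u x)) \<longlongrightarrow> H (u 1)) (at 1 within {0<..<1})"
          unfolding tendsto_at_iff_sequentially comp_def
        proof (intro allI impI)
          fix X assume X: "\<forall>i. X i \<in> {0<..<1::real} - {1}" "X \<longlonglongrightarrow> 1"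
          show "(\<lambda>n. H (u (X n))) \<longlonglongrightarrow> H (u 1)"
            unfolding H_def
          proof (rule upper_Gamma_integral_tendsto_boundary[OF k1 _ _ _ zero_less_one])
            show "(\<lambda>n. u (X n)) \<longlonglongrightarrow> u 1"
              using u_lim[of 1 "{0<..<1}"] X unfolding tendsto_at_iff_sequentially comp_def by simp
            fix n :: nat and v :: real assume v: "v > 0"
            have "X n > 0" "X n < 1" using X by auto
            then have "Re (u (X n)) = - (Re m * ln (X n))" by (simp add: u_def True Ln_of_real)
            also have "\<dots> \<ge> 0" using \<open>Re m > 0\<close> \<open>X n > 0\<close> \<open>X n < 1\<close>
              by (simp add: mult_nonneg_nonpos)
            finally show "1 * norm (u 1 + of_real v) \<le> norm (u (X n) + of_real v)"
              using complex_Re_le_cmod[of "u (X n) + of_real v"] v by (simp add: u_def True)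
          qed (simp_all add: u_def True)
        qed
        moreover have "at (1::real) within {0<..<1} = at_left 1"
          by (rule at_within_nhd[of _ "{0<..<2}"]) auto
        ultimately show ?thesis
          using upper_Gamma_eq_integral[OF k1] by (simp add: H_def u_def)
      next
        case False
        then have "Ln a \<noteq> 0" using L0[of 1] by simp
        then show ?thesis
          using 2 False by (intro lim_off_cut powr_mult_neg_of_Arg_sum_pos(1)[OF m _ m0]) auto
      qed
      then show "((\<lambda>x. upper_Gamma_integral (1 + k) (- (m * Ln (a * of_real x))))
            \<longlongrightarrow> upper_Gamma (1 + k) (- (m * Ln a))) (at_left 1)"
        by (simp add: H_def u_def)
    qed
  next
    case 3
    have ImL: "Im (Ln (a * of_real x)) < 0" if "x > 0" for x
      using 3 a that by (simp add: L Arg_eq_Im_Ln)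
    have cut: "Arg m = - Arg l" if "- (m * l) \<in> \<real>\<^sub>\<le>\<^sub>0" "Im l < 0" for l
    proof -
      define R where "R = Re (m * l)"
      have "Im (m * l) = 0" and R: "R \<ge> 0"
        using that by (auto simp: complex_nonpos_Reals_iff R_def)
      then have ml: "m * l = of_real R" by (simp add: complex_eq_iff R_def)
      have l: "l \<noteq> 0" using that by auto
      then have "R \<noteq> 0" using m ml by auto
      with R have R: "R > 0" by simp
      have "m * of_real ((norm l)\<^sup>2) = of_real R * cnj l"
        unfolding ml[symmetric] complex_norm_square by (simp add: mult_ac)
      then have "Arg (m * of_real ((norm l)\<^sup>2)) = Arg (of_real R * cnj l)" by simp
      then have "Arg m = Arg (cnj l)"
        using R l by (subst (asm) Arg_times_of_real2, simp) (subst (asm) Arg_times_of_real, simp_all)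
      also have "\<dots> = - Arg l" using that by (auto simp: Arg_cnj complex_is_Real_iff)
      finally show ?thesis .
    qed
    \<comment> \<open>The point \<open>u(x)\<close> lies on the cut only if \<open>Arg m + Arg (log (a x)) = 0\<close>, and this sum is at most
      \<open>0\<close> for \<open>x = 1\<close>. Below the real axis the argument of \<open>log (a x)\<close> strictly decreases as \<open>x\<close> decreases from \<open>1\<close>,
      so the sum is negative for \<open>x < 1\<close>.\<close>
    have off: "u x \<notin> \<real>\<^sub>\<le>\<^sub>0" if x: "0 < x" "x < 1" for x
    proof
      assume "u x \<in> \<real>\<^sub>\<le>\<^sub>0"
      then have "Arg m = - Arg (Ln (a * of_real x))"
        by (intro cut ImL x) (simp add: u_def)
      moreover have "Arg (Ln (a * of_real x)) < Arg (Ln (a * of_real x) + of_real (- ln x))"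
        using x ImL by (intro Arg_add_of_real_greater) auto
      then have "Arg (Ln (a * of_real x)) < Arg (Ln a)" using x by (simp add: L)
      ultimately show False using 3 by linarith
    qed
    show ?thesis
    proof (rule integral_powr_Ln_powr_if_branches[OF a m mk int])
      fix x :: real assume x: "0 < x" "x < 1" "a * of_real x \<noteq> 1"
      show "(upper_Gamma_integral (1 + k) has_field_derivative
         - ((- (m * Ln (a * of_real x))) powr k * exp (- (- (m * Ln (a * of_real x))))))
          (at (- (m * Ln (a * of_real x))))"
        using deriv[of x] off[OF x(1,2)] unfolding H_def u_def by blast
      show "Ln (a * of_real x) powr k = (- 1) powr k * m powr (- k) * (- (m * Ln (a * of_real x))) powr k"
        by (rule powr_int_mult_neg[OF 3(1) m L0[OF x(1,3)]])
    next
      fix x :: real assume "0 < x" "a * of_real x = 1"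
      then show "isCont (\<lambda>x. upper_Gamma_integral (1 + k) (- (m * Ln (a * of_real x)))) x"
        using ImL[of x] by simp
    next
      have "((\<lambda>x. H (u x)) \<longlongrightarrow> upper_Gamma (1 + k) (- (m * Ln a))) (at_left 1)"
      proof (cases "- (m * Ln a) \<in> \<real>\<^sub>\<le>\<^sub>0")
        case True
        have Im1: "Im (Ln a) < 0" using ImL[of 1] by simp
        then have nz: "m * Ln a \<noteq> 0" using m by auto
        then have z: "Re (- (m * Ln a)) < 0" "Im (- (m * Ln a)) = 0"
          using nonpos_Reals_nonzeroD[OF True] by simp_all
        have "Arg m = - Arg (Ln a)" by (rule cut[OF True Im1])
        then have "Arg m > 0" using Im1 by (simp flip: Arg_neg_iff)
        then have Imm: "Im m > 0" using m0 by (auto simp: Arg_pos_iff)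
        have "\<forall>\<^sub>F x in at_left (1::real). x \<in> {0<..<1}" by (rule eventually_at_left_real) simp
        then have "\<forall>\<^sub>F x in at_left 1. Im (u x) > 0"
        proof eventually_elim
          case (elim x)
          have "Im (u x) = Im (- (m * Ln a)) - Im m * ln x"
            using elim by (simp add: u_def L algebra_simps)
          also have "\<dots> > 0" using z(2) Imm elim by (simp add: mult_pos_neg)
          finally show ?case .
        qed
        moreover have "(u \<longlongrightarrow> - (m * Ln a)) (at_left 1)"
          using u_lim[of 1 "{..<1}"] by (simp add: u_def)
        ultimately have "filterlim u (at (- (m * Ln a)) within {q. Im q > 0}) (at_left 1)"
          using z(2) by (intro filterlim_at_within_upper_half_plane)
        from filterlim_compose[OF upper_Gamma_on_cut(1)[OF z, of "1 + k"] this]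
        show ?thesis by (simp add: H_def)
      qed (rule lim_off_cut)
      then show "((\<lambda>x. upper_Gamma_integral (1 + k) (- (m * Ln (a * of_real x))))
            \<longlongrightarrow> upper_Gamma (1 + k) (- (m * Ln a))) (at_left 1)"
        by (simp add: H_def u_def)
    qed
  qed
qed

section \<open>Expansion into a geometric series\<close>

theorem theorem3p1:
  fixes k a m :: complex and t :: real
  assumes "a \<noteq> 0" and "m \<noteq> 0"
    and "set_integrable lborel {0<..<1}
           (\<lambda>x::real. of_real x powr (-1 + m) * Ln (a * of_real x) powr k
                        / (1 - exp (\<i> * of_real t) * of_real x))"
    and "consistent_branches k a m"
  shows "(\<lambda>n::nat. a powr (- m - of_nat n) * exp (\<i> * of_nat n * of_real t) * (-1) powr k
                    * (m + of_nat n) powr (-1 - k)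
                    * upper_Gamma (1 + k) (- ((m + of_nat n) * Ln a)))
         sums (LBINT x:{0<..<1}. of_real x powr (-1 + m) * Ln (a * of_real x) powr k
                        / (1 - exp (\<i> * of_real t) * of_real x))"
proof -
  define e where "e = exp (\<i> * of_real t)"
  define h where "h = (\<lambda>x::real. of_real x powr (-1 + m) * Ln (a * of_real x) powr k)"
  define F where "F = (\<lambda>x. h x / (1 - e * of_real x))"
  have e: "norm e = 1" by (simp add: e_def)
  have [measurable]: "h \<in> borel_measurable borel" "F \<in> borel_measurable borel"
    unfolding h_def F_def by measurable
  have F: "set_integrable lborel {0<..<1} F"
    using assms(3) by (simp add: F_def h_def e_def)
  have ne: "1 - e * of_real x \<noteq> 0" if "0 < x" "x < 1" for x
  proof
    assume "1 - e * of_real x = 0"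
    then have "norm (e * of_real x) = 1" by simp
    then show False using that e by (simp add: norm_mult)
  qed
  have hF: "h x = F x * (1 - e * of_real x)" if "0 < x" "x < 1" for x
    using ne[OF that] by (simp add: F_def)
  have h: "set_integrable lborel {0<..<1} (\<lambda>x. of_real x ^ n * h x)" for n
  proof (rule set_integrable_dominated)
    show "set_integrable lborel {0<..<1} (\<lambda>x. 2 * norm (F x))"
      using F by (intro set_integrable_mult_right set_integrable_norm)
    show "set_borel_measurable lborel {0<..<1} (\<lambda>x. of_real x ^ n * h x)"
      unfolding set_borel_measurable_def by measurable
    fix x :: real assume x: "x \<in> {0<..<1}"
    have "norm (1 - e * of_real x) \<le> 2"
      using norm_triangle_ineq4[of 1 "e * of_real x"] e x by (simp add: norm_mult)
    then have "norm (F x) * norm (1 - e * of_real x) \<le> norm (F x) * 2"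
      by (rule mult_left_mono) simp
    moreover have "x ^ n * norm (h x) \<le> 1 * norm (h x)"
      using x by (intro mult_right_mono power_le_one) auto
    ultimately show "norm (of_real x ^ n * h x) \<le> 2 * norm (F x)"
      using x by (simp add: hF norm_mult norm_power)
  qed
  have "set_integrable lborel {0<..<1} h" using h[of 0] by simp
  from exponent_conditions_at_0[OF assms(1) this[unfolded h_def]]
  have m0: "Re m \<ge> 0" by auto
  define I where "I = (\<lambda>n. LBINT x:{0<..<1}. of_real x ^ n * h x)"
  have I: "I n = a powr (- m - of_nat n) * (-1) powr k * (m + of_nat n) powr (-1 - k)
                    * upper_Gamma (1 + k) (- ((m + of_nat n) * Ln a))" for n
  proof -
    have eq: "of_real x powr (- 1 + (m + of_nat n)) * Ln (a * of_real x) powr k = of_real x ^ n * h x"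
      if "x \<in> {0<..<1}" for x :: real
      using that by (simp add: h_def powr_add powr_nat' add.assoc[symmetric])
    have "set_integrable lborel {0<..<1}
            (\<lambda>x. of_real x powr (- 1 + (m + of_nat n)) * Ln (a * of_real x) powr k)"
      using h[of n] by (subst set_integrable_cong[OF refl refl eq]) auto
    moreover have "m + of_nat n \<noteq> 0"
      using m0 assms(2) by (cases "n = 0") (auto simp: complex_eq_iff)
    moreover have "consistent_branches k a (m + of_nat n)"
      by (rule consistent_branches_add_nat[OF assms(4) m0 assms(2,1)])
    ultimately have "(LBINT x:{0<..<1}. of_real x powr (- 1 + (m + of_nat n)) * Ln (a * of_real x) powr k)
       = a powr (- (m + of_nat n)) * (- 1) powr k * (m + of_nat n) powr (- 1 - k)
          * upper_Gamma (1 + k) (- ((m + of_nat n) * Ln a))"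
      by (intro integral_powr_Ln_powr assms(1))
    moreover have "(LBINT x:{0<..<1}. of_real x powr (- 1 + (m + of_nat n)) * Ln (a * of_real x) powr k) = I n"
      unfolding I_def by (rule set_lebesgue_integral_cong) (use eq in auto)
    ultimately show ?thesis by simp
  qed
  have partial: "(\<Sum>n<N. e ^ n * I n) = (LBINT x:{0<..<1}. F x * (1 - (e * of_real x) ^ N))" for N
  proof -
    have "(\<Sum>n<N. e ^ n * I n) = (\<Sum>n<N. LBINT x:{0<..<1}. e ^ n * (of_real x ^ n * h x))"
      by (simp add: I_def)
    also have "\<dots> = (LBINT x:{0<..<1}. \<Sum>n<N. e ^ n * (of_real x ^ n * h x))"
      unfolding set_lebesgue_integral_def scaleR_sum_right
      using set_integrable_mult_right[OF h] unfolding set_integrable_def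
      by (intro Bochner_Integration.integral_sum[symmetric]) blast
    also have "\<dots> = (LBINT x:{0<..<1}. F x * (1 - (e * of_real x) ^ N))"
    proof (rule set_lebesgue_integral_cong)
      show "\<forall>x. x \<in> {0<..<1} \<longrightarrow> (\<Sum>n<N. e ^ n * (of_real x ^ n * h x)) = F x * (1 - (e * of_real x) ^ N)"
      proof (intro allI impI)
        fix x :: real assume x: "x \<in> {0<..<1}"
        have "(\<Sum>n<N. e ^ n * (of_real x ^ n * h x)) = h x * (\<Sum>n<N. (e * of_real x) ^ n)"
          by (simp add: sum_distrib_left power_mult_distrib mult_ac)
        also have "\<dots> = F x * ((1 - e * of_real x) * (\<Sum>n<N. (e * of_real x) ^ n))"
          using x by (simp add: hF)
        also have "(1 - e * of_real x) * (\<Sum>n<N. (e * of_real x) ^ n) = 1 - (e * of_real x) ^ N"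
          by (rule one_diff_power_eq[symmetric])
        finally show "(\<Sum>n<N. e ^ n * (of_real x ^ n * h x)) = F x * (1 - (e * of_real x) ^ N)" .
      qed
    qed simp
    finally show ?thesis .
  qed
  have "(\<lambda>N. LINT x|lborel. indicator {0<..<1} x *\<^sub>R (F x * (1 - (e * of_real x) ^ N)))
         \<longlonglongrightarrow> (LINT x|lborel. indicator {0<..<1} x *\<^sub>R F x)"
  proof (rule integral_dominated_convergence)
    show "integrable lborel (\<lambda>x. indicator {0<..<1} x *\<^sub>R (2 * norm (F x)))"
      using F by (fold set_integrable_def) (intro set_integrable_mult_right set_integrable_norm)
    show "AE x in lborel. (\<lambda>N. indicator {0<..<1} x *\<^sub>R (F x * (1 - (e * of_real x) ^ N)))
            \<longlonglongrightarrow> indicator {0<..<1} x *\<^sub>R F x"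
    proof (intro AE_I2)
      fix x :: real
      show "(\<lambda>N. indicator {0<..<1} x *\<^sub>R (F x * (1 - (e * of_real x) ^ N)))
            \<longlonglongrightarrow> indicator {0<..<1} x *\<^sub>R F x"
      proof (cases "x \<in> {0<..<1}")
        case True
        then have "norm (e * of_real x) < 1" using e by (simp add: norm_mult)
        then have "(\<lambda>N. (e * of_real x) ^ N) \<longlonglongrightarrow> 0" by (rule LIMSEQ_power_zero)
        then have "(\<lambda>N. F x * (1 - (e * of_real x) ^ N)) \<longlonglongrightarrow> F x * (1 - 0)"
          by (rule tendsto_mult[OF tendsto_const tendsto_diff[OF tendsto_const]])
        then show ?thesis using True by simp
      qed simp
    qed
    show "AE x in lborel. norm (indicator {0<..<1} x *\<^sub>R (F x * (1 - (e * of_real x) ^ N)))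
            \<le> indicator {0<..<1} x *\<^sub>R (2 * norm (F x))" for N
    proof (intro AE_I2)
      fix x :: real
      show "norm (indicator {0<..<1} x *\<^sub>R (F x * (1 - (e * of_real x) ^ N)))
            \<le> indicator {0<..<1} x *\<^sub>R (2 * norm (F x))"
      proof (cases "x \<in> {0<..<1}")
        case True
        have "norm (1 - (e * of_real x) ^ N) \<le> 1 + norm ((e * of_real x) ^ N)"
          using norm_triangle_ineq4[of 1 "(e * of_real x) ^ N"] by simp
        also have "norm ((e * of_real x) ^ N) \<le> 1"
          using True e by (simp add: norm_power norm_mult power_le_one)
        finally have "norm (1 - (e * of_real x) ^ N) \<le> 2" by simp
        then have "norm (F x) * norm (1 - (e * of_real x) ^ N) \<le> norm (F x) * 2"
          by (rule mult_left_mono) simp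
        then show ?thesis using True by (simp add: norm_mult)
      qed simp
    qed
  qed measurable
  then have "(\<lambda>n. e ^ n * I n) sums (LBINT x:{0<..<1}. F x)"
    unfolding sums_def partial by (simp add: set_lebesgue_integral_def)
  moreover have "e ^ n = exp (\<i> * of_nat n * of_real t)" for n
    unfolding e_def by (simp add: exp_of_nat_mult[symmetric] mult_ac)
  ultimately show ?thesis
    by (simp add: I F_def h_def e_def mult_ac)
qed

end
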